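(* (Example with an atom and vanishing density at zero.) Denote by $J_m$ the $m\times m$ matrix whose entries are all equal to one. Let $k\ge 1$ be a fixed integer, assume that $n=km$ ($m\ge1$) and consider the $n\times n$ matrix, written in $k\times k$ blocks of size $m\times m$ (and assumed irreducible, as stated in the context), $$A_n=\begin{pmatrix}0&J_m&\cdots&J_m\\ J_m&0&\cdots&0\\ \vdots&\vdots&&\vdots\\ J_m&0&\cdots&0\end{pmatrix}.$$ Associated to $A_n$ is the sequence of normalized variance profiles $V_n=\frac1nA_n\odot A_n$ ($\odot$ is the entrywise product) with spectral radius $\rho(V_n)=\frac{\sqrt{k-1}}{k}$. Denote $\rho^*=\sqrt{\rho(V_n)}=\frac{\sqrt[4]{k-1}}{\sqrt k}$, and let $F_n$, $\mu_n$, $f_n$ be associated with $V_n$ as in the context. Then: (1) Assumptions (A1) and (A2) of the context hold true for the family $(A_n)_{n=km,\,m\ge1}$. (2) The function $F_n$ does not depend on $n$ and is given by $$F_n(s)=F_\infty(s)=\frac1k\sqrt{(k-2)^2+4k^2s^4}\quad\text{if }0\le s\le\rho^*,$$ and $F_\infty(s)=1$ if $s>\rho^*$. In particular, $F_\infty(0)=1-\frac2k$ and $\lim_{s\uparrow\rho^*}F_\infty(s)=1$. (3) The density $f_n(=f_\infty)$ and the measure $\mu_n(=\mu_\infty)$ do not depend on $n$ and are given by $$f_\infty(z)=\frac{4k}{\pi}\frac{|z|^2}{\sqrt{(k-2)^2+4k^2|z|^4}}\mathbf 1_{\{|z|\le\rho^*\}},$$ $$\mu_\infty(dz)=\Big(1-\frac2k\Big)\delta_0(dz)+\frac{4k}{\pi}\frac{|z|^2}{\sqrt{(k-2)^2+4k^2|z|^4}}\mathbf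 1_{\{|z|\le\rho^*\}}\,\ell(dz),$$ where $\ell$ is Lebesgue measure on $\mathbb{C}$. In particular, $f_\infty(0)=0$.
   Context: Write $[n]=\{1,\dots,n\}$, and $\rho(\cdot)$ for the spectral radius. For an $n\times n$ matrix $A_n=(\sigma_{ij}^{(n)})$ with nonnegative entries (standard deviation profile), $V_n=\big(\tfrac1n(\sigma_{ij}^{(n)})^2\big)$ is the normalized variance profile. Standing assumption: $A_n$ is irreducible. (A1) There is $\sigma_{\max}\in(0,\infty)$ with $\sup_n\max_{i,j}\sigma_{ij}^{(n)}\le\sigma_{\max}$. For $s,t>0$, let $r(s,t),\widetilde r(s,t)\in(0,\infty)^n$ be the unique entrywise positive solution of $$r_i=\frac{(V_n^{\mathsf T}r)_i+t}{s^2+((V_n\widetilde r)_i+t)((V_n^{\mathsf T}r)_i+t)},\qquad \widetilde r_i=\frac{(V_n\widetilde r)_i+t}{s^2+((V_n\widetilde r)_i+t)((V_n^{\mathsf T}r)_i+t)},\quad i\in[n].$$ (A2) (admissibility) For all $s>0$ there is a constant $C=C(s)>0$ such that $\sup_{n}\sup_{t\in(0,1]}\frac1n\sum_{i\in[n]}r_i(s,t)\le C$. Master Equations: for $s>0$, consider $$q_i=\frac{(V_n^{\mathsf T}q)_i}{s^2+(V_n\widetilde q)_i(V_n^{\mathsf T}q)_i},\quad \widetilde q_i=\frac{(V_n\widetilde q)_i}{s^2+(V_n\widetilde q)_i(V_n^{\mathsf T}q)_i},\quad \sum_{i}q_i=\sum_i\widetilde q_i,\quad q_i,\widetilde q_i\ge0,\quad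 i\in[n].$$ It is known that, for irreducible $A_n$, this system has only the zero solution when $s\ge\sqrt{\rho(V_n)}$ and has a unique nonzero solution (which is entrywise positive) when $s\in(0,\sqrt{\rho(V_n)})$. $(q(s),\widetilde q(s))$ denotes this nonzero solution when $s<\sqrt{\rho(V_n)}$ and $0$ when $s\ge\sqrt{\rho(V_n)}$. The function $F_n(s)=1-\frac1n\langle q(s),V_n\widetilde q(s)\rangle$, $s>0$, extends to an absolutely continuous function on $[0,\infty)$ which is the CDF of a probability measure; $\mu_n$ is the unique radially symmetric probability measure on $\mathbb{C}$ with $\mu_n(\{z:|z|\le s\})=F_n(s)$ for all $s>0$, and $f_n$ is its density on $\mathbb{C}\setminus\{0\}$ with respect to Lebesgue measure. *)

theory Defs
  imports "HOL-Probability.Probability" "Jordan_Normal_Form.Spectral_Radius"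
begin

no_notation vec_nth (infixl "$" 90)
no_notation inner (infix "\<bullet>" 70)

text \<open>
  Matrices and vectors are those of \<^theory>\<open>Jordan_Normal_Form.Matrix\<close>, so the dimension
  \<open>n = dim_row A\<close> may vary along a family; indices run over \<open>0, ..., n - 1\<close>.
\<close>

text \<open>
  Irreducibility: the directed graph with an arc \<open>i \<rightarrow> j\<close> whenever \<open>A\<^sub>i\<^sub>j \<noteq> 0\<close> is
  strongly connected. Using the transitive (not reflexive) closure means that
  the \<open>1 \<times> 1\<close> zero matrix is not irreducible.
\<close>

definition irreducible_mat :: "real mat \<Rightarrow> bool" where
  "irreducible_mat A \<longleftrightarrow>
     (\<forall>i<dim_row A. \<forall>j<dim_row A.
        (i, j) \<in> {(u, v). u < dim_row A \<and> v < dim_row A \<and> A $$ (u, v) \<noteq> 0}\<^sup>+)"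

definition variance_profile :: "real mat \<Rightarrow> real mat" where
  "variance_profile A =
     Matrix.mat (dim_row A) (dim_col A) (\<lambda>(i, j). (A $$ (i, j))\<^sup>2 / real (dim_row A))"

definition rho :: "real mat \<Rightarrow> real" where
  "rho V = spectral_radius (map_mat complex_of_real V)"

definition reg_master_eqs :: "real mat \<Rightarrow> real \<Rightarrow> real \<Rightarrow> real Matrix.vec \<times> real Matrix.vec \<Rightarrow> bool" where
  "reg_master_eqs V s t = (\<lambda>(r, r').
     r \<in> carrier_vec (dim_row V) \<and> r' \<in> carrier_vec (dim_row V) \<and>
     (\<forall>i<dim_row V. 0 < r $ i \<and> 0 < r' $ i \<and>
        r $ i = ((transpose_mat V *\<^sub>v r) $ i + t)
                / (s\<^sup>2 + ((V *\<^sub>v r') $ i + t) * ((transpose_mat V *\<^sub>v r) $ i + t)) \<and>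
        r' $ i = ((V *\<^sub>v r') $ i + t)
                / (s\<^sup>2 + ((V *\<^sub>v r') $ i + t) * ((transpose_mat V *\<^sub>v r) $ i + t))))"

definition reg_sol :: "real mat \<Rightarrow> real \<Rightarrow> real \<Rightarrow> real Matrix.vec \<times> real Matrix.vec" where
  "reg_sol V s t = (THE p. reg_master_eqs V s t p)"

definition assumption_A1 :: "real mat set \<Rightarrow> bool" where
  "assumption_A1 \<A> \<longleftrightarrow>
     (\<exists>\<sigma>max>0. \<forall>A\<in>\<A>. \<forall>i<dim_row A. \<forall>j<dim_col A. A $$ (i, j) \<le> \<sigma>max)"

definition assumption_A2 :: "real mat set \<Rightarrow> bool" where
  "assumption_A2 \<A> \<longleftrightarrow>
     (\<forall>s>0. \<exists>C>0. \<forall>A\<in>\<A>. \<forall>t\<in>{0<..1}.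
        (\<Sum>i<dim_row A. fst (reg_sol (variance_profile A) s t) $ i) / real (dim_row A) \<le> C)"

definition master_eqs :: "real mat \<Rightarrow> real \<Rightarrow> real Matrix.vec \<times> real Matrix.vec \<Rightarrow> bool" where
  "master_eqs V s = (\<lambda>(q, q').
     q \<in> carrier_vec (dim_row V) \<and> q' \<in> carrier_vec (dim_row V) \<and>
     (\<Sum>i<dim_row V. q $ i) = (\<Sum>i<dim_row V. q' $ i) \<and>
     (\<forall>i<dim_row V. 0 \<le> q $ i \<and> 0 \<le> q' $ i \<and>
        q $ i = (transpose_mat V *\<^sub>v q) $ i
                / (s\<^sup>2 + (V *\<^sub>v q') $ i * (transpose_mat V *\<^sub>v q) $ i) \<and>
        q' $ i = (V *\<^sub>v q') $ i
                / (s\<^sup>2 + (V *\<^sub>v q') $ i * (transpose_mat V *\<^sub>v q) $ i)))"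

definition master_sol :: "real mat \<Rightarrow> real \<Rightarrow> real Matrix.vec \<times> real Matrix.vec" where
  "master_sol V s =
     (if s < sqrt (rho V)
      then THE p. master_eqs V s p \<and> p \<noteq> (0\<^sub>v (dim_row V), 0\<^sub>v (dim_row V))
      else (0\<^sub>v (dim_row V), 0\<^sub>v (dim_row V)))"

definition F_pos :: "real mat \<Rightarrow> real \<Rightarrow> real" where
  "F_pos V s = (case master_sol V s of
     (q, q') \<Rightarrow> 1 - scalar_prod q (V *\<^sub>v q') / real (dim_row V))"

text \<open>The value at \<open>0\<close> is that of the continuous extension from \<open>(0, \<infinity>)\<close>.\<close>

definition F :: "real mat \<Rightarrow> real \<Rightarrow> real" where
  "F V s = (if s = 0 then Lim (at_right 0) (F_pos V) else F_pos V s)"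

definition radially_symmetric :: "complex measure \<Rightarrow> bool" where
  "radially_symmetric \<mu> \<longleftrightarrow> (\<forall>\<theta>. distr \<mu> borel (\<lambda>z. cis \<theta> * z) = \<mu>)"

definition mu :: "real mat \<Rightarrow> complex measure" where
  "mu V = (THE \<mu>. sets \<mu> = sets borel \<and> prob_space \<mu> \<and> radially_symmetric \<mu> \<and>
     (\<forall>s>0. measure \<mu> {z. cmod z \<le> s} = F V s))"

text \<open>
  \<open>f\<close> is a density of \<open>\<mu>\<close> on the punctured plane with respect to Lebesgue measure; this
  determines \<open>f\<close> up to a null set, and does not constrain \<open>f 0\<close>.
\<close>

definition density_off_0 :: "complex measure \<Rightarrow> (complex \<Rightarrow> real) \<Rightarrow> bool" where
  "density_off_0 \<mu> f \<longleftrightarrow>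
     f \<in> borel_measurable borel \<and> (\<forall>z. 0 \<le> f z) \<and>
     (\<forall>B\<in>sets borel. 0 \<notin> B \<longrightarrow> emeasure \<mu> B = (\<integral>\<^sup>+z\<in>B. ennreal (f z) \<partial>lborel))"

text \<open>
  Entry \<open>(i, j)\<close> lies in the \<open>m \<times> m\<close> block \<open>(i div m, j div m)\<close>; the blocks equal to \<open>J\<^sub>m\<close> are
  those in the first block row or first block column, except block \<open>(0, 0)\<close>.
\<close>

definition A_ex :: "nat \<Rightarrow> nat \<Rightarrow> real mat" where
  "A_ex k m = Matrix.mat (k * m) (k * m)
     (\<lambda>(i, j). if (i div m = 0 \<and> j div m \<noteq> 0) \<or> (i div m \<noteq> 0 \<and> j div m = 0) then 1 else 0)"

definition V_ex :: "nat \<Rightarrow> nat \<Rightarrow> real mat" where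
  "V_ex k m = variance_profile (A_ex k m)"

definition rho_star :: "nat \<Rightarrow> real" where
  "rho_star k = root 4 (real k - 1) / sqrt (real k)"

definition F_inf :: "nat \<Rightarrow> real \<Rightarrow> real" where
  "F_inf k s = (if s \<le> rho_star k
     then 1 / real k * sqrt ((real k - 2)\<^sup>2 + 4 * (real k)\<^sup>2 * s ^ 4) else 1)"

text \<open>For \<open>k = 2\<close> the quotient at \<open>z = 0\<close> is \<open>0 / 0\<close>, which is \<open>0\<close> in HOL.\<close>

definition f_inf :: "nat \<Rightarrow> complex \<Rightarrow> real" where
  "f_inf k z = 4 * real k / pi
     * ((cmod z)\<^sup>2 / sqrt ((real k - 2)\<^sup>2 + 4 * (real k)\<^sup>2 * cmod z ^ 4))
     * indicator {z. cmod z \<le> rho_star k} z"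

end

theory Submission
  imports Defs
begin

text \<open>
  The matrix couples only two groups of indices, the first block and all the others, which make up
  the proportions \<open>1 / k\<close> and \<open>1 - 1 / k\<close> of all indices. On vectors constant on both groups
  the variance profile acts as the antidiagonal \<open>2 \<times> 2\<close> matrix with entries \<open>c = 1 - 1 / k\<close> and
  \<open>d = 1 / k\<close> (\<open>V_ex_mult_blockvec_of_real\<close>), and every image vector is constant on both groups.
  The spectral radius \<open>sqrt (c d)\<close> follows at once, and both systems of equations collapse to
  scalar equations for the two values \<open>x, y\<close> of \<open>V q + t\<close> and the values \<open>x', y'\<close> of
  \<open>V q' + t\<close> (\<open>blockvec_of_fixed_point\<close>). The profile is symmetric, and in both systems the two
  sides of the solution agree: \<open>x' = x\<close> and \<open>y' = y\<close>.

  For \<open>t > 0\<close> the solutions exist by the intermediate value theorem and are unique by a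
  contraction estimate (\<open>coupled_eqs_exist\<close>, \<open>coupled_eqs_unique\<close>). Existence and uniqueness matter
  because the regularised solution is a definite description. As both sides agree, each entry is
  \<open>z / (s\<^sup>2 + z\<^sup>2) \<le> 1 / (2 s)\<close>, which is admissibility.

  For \<open>t = 0\<close> the product \<open>p = x y\<close> satisfies \<open>(c - p) (d - p) = s\<^sup>4\<close> (\<open>limit_eqs_product\<close>).
  A positive solution exists if and only if \<open>s\<^sup>4 < c d\<close>, that is, \<open>s\<close> is below the edge, and
  \<open>F = 1 - 2 p\<close> is the announced square root.

  The measure with the atom and the density of the theorem is radially symmetric by rotation
  invariance of Lebesgue measure (\<open>nn_integral_lborel_rotate\<close>), and integration in polar coordinates
  shows that the distribution function of its radius is \<open>F\<close>. A radially symmetric probability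
  measure is determined by the law of its radius (\<open>radially_symmetric_measure_eqI\<close>), so it is the
  measure in question.
\<close>

section \<open>The variance profile on two-valued vectors\<close>

text \<open>
  The profile only sees whether an index lies in the first block of length \<open>m\<close> or not, so
  all solutions of the equations have this shape; all blocks after the first are merged.
\<close>

definition blockvec :: "nat \<Rightarrow> nat \<Rightarrow> 'a \<Rightarrow> 'a \<Rightarrow> 'a Matrix.vec" where
  "blockvec k m a b = Matrix.vec (k * m) (\<lambda>i. if i < m then a else b)"

lemma blockvec_carrier [simp]: "blockvec k m a b \<in> carrier_vec (k * m)"
  by (simp add: blockvec_def)

lemma dim_blockvec [simp]: "dim_vec (blockvec k m a b) = k * m"
  by (simp add: blockvec_def)

lemma index_blockvec [simp]: "i < k * m \<Longrightarrow> blockvec k m a b $ i = (if i < m then a else b)"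
  by (simp add: blockvec_def)

lemma blockvec_eq_iff:
  assumes "k \<ge> 2" "m \<ge> 1"
  shows "blockvec k m a b = blockvec k m a' b' \<longleftrightarrow> a = a' \<and> b = b'"
proof
  assume eq: "blockvec k m a b = blockvec k m a' b'"
  have "2 * m \<le> k * m" using assms by (intro mult_right_mono) auto
  with assms have "0 < k * m" "m < k * m" by linarith+
  note ix = index_blockvec[OF this(1)] index_blockvec[OF this(2)]
  show "a = a' \<and> b = b'"
    using arg_cong[OF eq, of "\<lambda>v. v $ 0"] arg_cong[OF eq, of "\<lambda>v. v $ m"] assms(2)
    unfolding ix by simp
qed simp

lemma sum_blocks:
  fixes f :: "nat \<Rightarrow> 'a :: comm_ring_1"
  assumes "k \<ge> 1"
  shows "(\<Sum>i<k * m. f i) = (\<Sum>i<m. f i) + (\<Sum>i=m..<k * m. f i)"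
  using assms sum.atLeastLessThan_concat[of 0 m "k * m" f] by (simp add: atLeast0LessThan)

lemma sum_block_const:
  assumes "k \<ge> 1"
  shows "(\<Sum>i<k * m. if i < m then a else b) = real m * a + (real k - 1) * real m * b"
proof -
  have "(\<Sum>i<k * m. if i < m then a else b) = (\<Sum>i<m. a) + (\<Sum>i=m..<k * m. b)"
    unfolding sum_blocks[OF assms] by (intro arg_cong2[where f = "(+)"] sum.cong) auto
  also have "\<dots> = real m * a + real (k * m - m) * b"
    by simp
  also have "real (k * m - m) = (real k - 1) * real m"
    using assms by (subst of_nat_diff) (auto simp: algebra_simps)
  finally show ?thesis .
qed

lemma V_ex_carrier: "V_ex k m \<in> carrier_mat (k * m) (k * m)"
  by (auto simp: V_ex_def variance_profile_def A_ex_def)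

lemma dim_V_ex [simp]: "dim_row (V_ex k m) = k * m" "dim_col (V_ex k m) = k * m"
  by (auto simp: V_ex_def variance_profile_def A_ex_def)

lemma index_V_ex:
  assumes "m \<ge> 1" "i < k * m" "j < k * m"
  shows "V_ex k m $$ (i, j) = (if (i < m) = (j < m) then 0 else 1 / (real k * real m))"
  using assms by (auto simp: V_ex_def variance_profile_def A_ex_def div_eq_0_iff)

lemma transpose_V_ex: "m \<ge> 1 \<Longrightarrow> transpose_mat (V_ex k m) = V_ex k m"
  by (rule eq_matI) (auto simp: index_V_ex)

text \<open>
  The image of every vector is constant on both parts, with values given by the mass of the other
  part. The statement is over any real field because the master equations use real vectors while the
  spectral radius uses complex ones.
\<close>

lemma V_ex_mult_vec_of_real:
  fixes w :: "'a :: real_field Matrix.vec"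
  assumes k: "k \<ge> 1" and m: "m \<ge> 1" and w: "w \<in> carrier_vec (k * m)"
  shows "map_mat of_real (V_ex k m) *\<^sub>v w =
    blockvec k m ((\<Sum>j=m..<k * m. w $ j) / of_nat (k * m)) ((\<Sum>j<m. w $ j) / of_nat (k * m))"
proof (rule eq_vecI)
  fix i assume "i < dim_vec (blockvec k m ((\<Sum>j=m..<k * m. w $ j) / of_nat (k * m)) ((\<Sum>j<m. w $ j) / of_nat (k * m)))"
  then have i: "i < k * m" by simp
  have "(map_mat of_real (V_ex k m) *\<^sub>v w) $ i = (\<Sum>j<k * m. of_real (V_ex k m $$ (i, j)) * w $ j)"
    using i w by (simp add: scalar_prod_def atLeast0LessThan)
  also have "\<dots> = (\<Sum>j<m. of_real (V_ex k m $$ (i, j)) * w $ j) + (\<Sum>j=m..<k * m. of_real (V_ex k m $$ (i, j)) * w $ j)"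
    by (rule sum_blocks[OF k])
  also have "(\<Sum>j<m. of_real (V_ex k m $$ (i, j)) * w $ j) = (\<Sum>j<m. (if i < m then 0 else 1 / of_nat (k * m)) * w $ j)"
  proof (rule sum.cong)
    fix j assume "j \<in> {..<m}"
    then have "j < m" "j < k * m" using k by (auto intro: less_le_trans)
    then show "of_real (V_ex k m $$ (i, j)) * w $ j = (if i < m then 0 else 1 / of_nat (k * m)) * w $ j"
      using i m by (simp add: index_V_ex)
  qed simp
  also have "(\<Sum>j=m..<k * m. of_real (V_ex k m $$ (i, j)) * w $ j)
      = (\<Sum>j=m..<k * m. (if i < m then 1 / of_nat (k * m) else 0) * w $ j)"
    using i m by (intro sum.cong) (auto simp: index_V_ex)
  finally show "(map_mat of_real (V_ex k m) *\<^sub>v w) $ i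
      = blockvec k m ((\<Sum>j=m..<k * m. w $ j) / of_nat (k * m)) ((\<Sum>j<m. w $ j) / of_nat (k * m)) $ i"
    using i by (auto simp: sum_divide_distrib)
qed simp

text \<open>
  On two-valued vectors the profile acts as a \<open>2 \<times> 2\<close> antidiagonal matrix with entries
  \<open>1 - 1/k\<close> and \<open>1/k\<close>, the proportions of the two parts. This is why \<open>m\<close> disappears.
\<close>

lemma V_ex_mult_blockvec_of_real:
  fixes a b :: "'a :: real_field"
  assumes k: "k \<ge> 1" and m: "m \<ge> 1"
  shows "map_mat of_real (V_ex k m) *\<^sub>v blockvec k m a b
     = blockvec k m ((1 - 1 / of_nat k) * b) (1 / of_nat k * a)"
proof -
  have nz: "(of_nat m :: 'a) \<noteq> 0" "(of_nat k :: 'a) \<noteq> 0" using k m by auto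
  have "(\<Sum>j<m. blockvec k m a b $ j) = (\<Sum>j<m. a)"
  proof (rule sum.cong)
    fix j assume "j \<in> {..<m}"
    moreover from this have "j < k * m" using k by (auto intro: less_le_trans)
    ultimately show "blockvec k m a b $ j = a" by simp
  qed simp
  then have 1: "(\<Sum>j<m. blockvec k m a b $ j) / of_nat (k * m) = 1 / of_nat k * a"
    using nz by simp
  have "(\<Sum>j=m..<k * m. blockvec k m a b $ j) = (\<Sum>j=m..<k * m. b)"
    by (intro sum.cong) auto
  also have "\<dots> = of_nat (k * m - m) * b" by simp
  also have "of_nat (k * m - m) = (of_nat k - 1) * (of_nat m :: 'a)"
    using k by (subst of_nat_diff) (auto simp: algebra_simps)
  finally have 2: "(\<Sum>j=m..<k * m. blockvec k m a b $ j) / of_nat (k * m) = (1 - 1 / of_nat k) * b"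
    using nz by (simp add: field_simps)
  show ?thesis
    using V_ex_mult_vec_of_real[OF k m, of "blockvec k m a b"] by (simp only: 1 2 blockvec_carrier)
qed

lemma map_mat_of_real_real: "map_mat of_real (A :: real mat) = A"
  by (rule eq_matI) auto

lemmas V_ex_mult_vec = V_ex_mult_vec_of_real[where 'a = real, unfolded map_mat_of_real_real]
lemmas V_ex_mult_blockvec = V_ex_mult_blockvec_of_real[where 'a = real, unfolded map_mat_of_real_real]

text \<open>
  The square of the antidiagonal matrix is \<open>r\<^sup>2\<close> times the identity, and the image of
  every vector is two-valued, so \<open>A\<^sup>3 = r\<^sup>2 A\<close>. Hence each eigenvalue is \<open>0\<close> or
  \<open>\<plusminus>r\<close>, and \<open>r\<close> is attained at the vector with values \<open>k r\<close> and \<open>1\<close>.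
\<close>

lemma rho_V_ex:
  assumes k: "k \<ge> 2" and m: "m \<ge> 1"
  shows "rho (V_ex k m) = sqrt (real k - 1) / real k"
proof -
  define A where "A = map_mat complex_of_real (V_ex k m)"
  have A: "A \<in> carrier_mat (k * m) (k * m)"
    using V_ex_carrier by (simp add: A_def)
  have k1: "k \<ge> 1" using k by simp
  define r where "r = sqrt (real k - 1) / real k"
  have r: "r > 0" "r\<^sup>2 = (1 - 1 / real k) * (1 / real k)"
    using k by (auto simp: r_def power_divide power2_eq_square[of "real k"] field_simps)
  have le: "cmod l \<le> r" if "eigenvalue A l" for l
  proof -
    from that obtain v where v: "v \<in> carrier_vec (k * m)" "v \<noteq> 0\<^sub>v (k * m)" "A *\<^sub>v v = l \<cdot>\<^sub>v v"
      using A by (auto simp: eigenvalue_def eigenvector_def)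
    obtain a b where ab: "A *\<^sub>v v = blockvec k m a b"
      using V_ex_mult_vec_of_real[OF k1 m v(1)] by (auto simp: A_def)
    have "A *\<^sub>v (A *\<^sub>v (A *\<^sub>v v)) = complex_of_real (r\<^sup>2) \<cdot>\<^sub>v (A *\<^sub>v v)"
      unfolding ab unfolding A_def V_ex_mult_blockvec_of_real[OF k1 m] r
      by (rule eq_vecI) auto
    moreover have "A *\<^sub>v (A *\<^sub>v (A *\<^sub>v v)) = (l * l * l) \<cdot>\<^sub>v v"
      using A v(1) by (simp add: v(3) mult_mat_vec[OF A] smult_smult_assoc mult.assoc)
    ultimately have eq: "(l * l * l) \<cdot>\<^sub>v v = (complex_of_real (r\<^sup>2) * l) \<cdot>\<^sub>v v"
      by (simp add: v(3) smult_smult_assoc)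
    obtain i where i: "i < k * m" "v $ i \<noteq> 0"
      using v(1,2) by (metis carrier_vecD eq_vecI index_zero_vec(1,2))
    from arg_cong[OF eq, of "\<lambda>x. x $ i"] i v(1) have "l * l * l = complex_of_real (r\<^sup>2) * l"
      by auto
    then have "l = 0 \<or> l\<^sup>2 = (complex_of_real r)\<^sup>2"
      by (auto simp: power2_eq_square)
    then have "l = 0 \<or> l = complex_of_real r \<or> l = - complex_of_real r"
      by (simp only: power2_eq_iff)
    then show ?thesis using r(1) by auto
  qed
  have "eigenvalue A (complex_of_real r)"
  proof -
    define v where "v = blockvec k m (complex_of_real (real k * r)) 1"
    have "A *\<^sub>v v = complex_of_real r \<cdot>\<^sub>v v"
    proof -
      have "complex_of_real r * complex_of_real (real k * r) = complex_of_real (real k * r\<^sup>2)"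
        by (simp add: power2_eq_square)
      also have "real k * r\<^sup>2 = 1 - 1 / real k"
        using k unfolding r by simp
      finally show ?thesis
        using k unfolding v_def A_def V_ex_mult_blockvec_of_real[OF k1 m]
        by (intro eq_vecI) auto
    qed
    moreover have "v \<noteq> 0\<^sub>v (k * m)"
    proof
      assume "v = 0\<^sub>v (k * m)"
      also have "0\<^sub>v (k * m) = blockvec k m 0 (0 :: complex)" by (auto simp: blockvec_def)
      finally show False unfolding v_def by (simp add: blockvec_eq_iff[OF k m])
    qed
    ultimately show ?thesis
      using A blockvec_carrier[of k m] unfolding eigenvalue_def eigenvector_def v_def
      by (metis carrier_matD(1))
  qed
  then have "r \<in> cmod ` spectrum A"
    using r(1) by (force simp: spectrum_def)
  moreover have "finite (cmod ` spectrum A)"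
    using card_finite_spectrum(1)[OF A] by simp
  moreover have "y \<le> r" if "y \<in> cmod ` spectrum A" for y
    using that le by (auto simp: spectrum_def)
  ultimately have "spectral_radius A = r"
    unfolding spectral_radius_def by (intro Max_eqI)
  then show ?thesis by (simp add: rho_def A_def r_def)
qed

section \<open>Scalar equations\<close>

lemma clear_denominator:
  fixes x t c y P :: real
  assumes "x = t + c * (y / P)" "P > 0"
  shows "(x - t) * P = c * y"
  using assms by simp

text \<open>
  Reduction of the four scalar unknowns to two. Subtracting the equations gives
  \<open>(x - x') P = c (y - y')\<close> and \<open>(y - y') Q = d (x - x')\<close>, so different sides force
  \<open>P Q = c d\<close>. But the equations themselves give \<open>(x - t) (y - t) P Q = c d x y\<close> with
  \<open>0 < x - t < x\<close> and \<open>0 < y - t < y\<close>, so \<open>P Q > c d\<close>. Here \<open>t > 0\<close> is essential.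
\<close>

lemma coupled_eqs_unique_side:
  fixes c d s t x y x' y' :: real
  assumes pos: "c > 0" "d > 0" "t > 0" "y > 0" "x > 0" "y' > 0" "x' > 0" "s > 0"
    and x: "x = t + c * (y / (s\<^sup>2 + y' * y))" and y: "y = t + d * (x / (s\<^sup>2 + x' * x))"
    and x': "x' = t + c * (y' / (s\<^sup>2 + y' * y))" and y': "y' = t + d * (x' / (s\<^sup>2 + x' * x))"
  shows "x' = x \<and> y' = y"
proof -
  define P where "P = s\<^sup>2 + y' * y"
  define Q where "Q = s\<^sup>2 + x' * x"
  have P: "P > 0" and Q: "Q > 0" using pos by (auto simp: P_def Q_def add_pos_pos)
  have eqs: "(x - t) * P = c * y" "(y - t) * Q = d * x" "(x' - t) * P = c * y'" "(y' - t) * Q = d * x'"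
    using clear_denominator[OF x[folded P_def] P] clear_denominator[OF y[folded Q_def] Q]
      clear_denominator[OF x'[folded P_def] P] clear_denominator[OF y'[folded Q_def] Q] .
  have dx: "(x - x') * P = c * (y - y')" and dy: "(y - y') * Q = d * (x - x')"
    using eqs by (simp_all add: algebra_simps)
  have "x = x'"
  proof (rule ccontr)
    assume "x \<noteq> x'"
    have "(x - x') * (P * Q) = c * ((y - y') * Q)"
      using dx by (metis mult.assoc)
    then have "(x - x') * (P * Q) = (x - x') * (c * d)"
      unfolding dy by (simp add: mult_ac)
    with \<open>x \<noteq> x'\<close> have PQ: "P * Q = c * d" by simp
    have "((x - t) * P) * ((y - t) * Q) = (c * d) * (x * y)"
      unfolding eqs by (simp add: mult_ac)
    then have "(c * d) * ((x - t) * (y - t)) = (c * d) * (x * y)"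
      unfolding PQ[symmetric] by (simp add: mult_ac)
    then have "(x - t) * (y - t) = x * y"
      using pos by simp
    moreover have "(x - t) * P > 0"
      using eqs(1) pos by simp
    then have "x > t" using P by (simp add: zero_less_mult_iff)
    then have "t * (x - t) + t * y > 0" using pos by (simp add: add_pos_pos)
    ultimately show False by (simp add: algebra_simps)
  qed
  with dy Q show ?thesis by simp
qed

text \<open>
  A contraction argument. For two solutions, the difference quotients of \<open>z / (s\<^sup>2 + z\<^sup>2)\<close>
  have numerators \<open>a = s\<^sup>2 - y1 y2\<close> and \<open>b = s\<^sup>2 - x1 x2\<close>, whose squares are bounded by the
  denominators \<open>P1 P2\<close> and \<open>Q1 Q2\<close>. Distinct solutions would give
  \<open>P1 P2 Q1 Q2 = c d a b\<close>, hence \<open>P1 P2 Q1 Q2 \<le> (c d)\<^sup>2\<close>, whereas each solution satisfies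
  \<open>P Q > c d\<close>.
\<close>

lemma coupled_eqs_unique:
  fixes c d s t x1 y1 x2 y2 :: real
  assumes pos: "c > 0" "d > 0" "t > 0" "x1 > 0" "y1 > 0" "x2 > 0" "y2 > 0" "s > 0"
    and x1: "x1 = t + c * (y1 / (s\<^sup>2 + y1 * y1))" and y1: "y1 = t + d * (x1 / (s\<^sup>2 + x1 * x1))"
    and x2: "x2 = t + c * (y2 / (s\<^sup>2 + y2 * y2))" and y2: "y2 = t + d * (x2 / (s\<^sup>2 + x2 * x2))"
  shows "x1 = x2 \<and> y1 = y2"
proof -
  define P1 Q1 P2 Q2 where "P1 = s\<^sup>2 + y1 * y1" "Q1 = s\<^sup>2 + x1 * x1" "P2 = s\<^sup>2 + y2 * y2" "Q2 = s\<^sup>2 + x2 * x2"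
  note defs = this
  have P: "P1 > 0" "Q1 > 0" "P2 > 0" "Q2 > 0"
    using pos by (auto simp: defs add_pos_pos)
  have eqs: "(x1 - t) * P1 = c * y1" "(y1 - t) * Q1 = d * x1" "(x2 - t) * P2 = c * y2" "(y2 - t) * Q2 = d * x2"
    using clear_denominator[OF x1[folded defs] P(1)] clear_denominator[OF y1[folded defs] P(2)]
      clear_denominator[OF x2[folded defs] P(3)] clear_denominator[OF y2[folded defs] P(4)] .
  have large: "P * Q > c * d"
    if "(x - t) * P = c * y" "(y - t) * Q = d * x" "x > 0" "y > 0" "P > 0" "Q > 0" for x y P Q
  proof -
    have "(x - t) * P > 0" "(y - t) * Q > 0" using that pos by simp_all
    then have xy: "x > t" "y > t"
      using zero_less_mult_pos2[of "x - t" P] zero_less_mult_pos2[of "y - t" Q] that(5,6) by simp_all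
    have "(c * d) * ((x - t) * (y - t)) < (c * d) * (x * y)"
      using xy pos by (intro mult_strict_left_mono mult_strict_mono) auto
    also have "\<dots> = ((x - t) * P) * ((y - t) * Q)"
      unfolding that(1,2) by (simp add: mult_ac)
    also have "\<dots> = (P * Q) * ((x - t) * (y - t))"
      by (simp add: mult_ac)
    finally show ?thesis
      using xy by simp
  qed
  have W1: "P1 * Q1 > c * d" by (rule large[OF eqs(1,2)]) (use pos P in auto)
  have W2: "P2 * Q2 > c * d" by (rule large[OF eqs(3,4)]) (use pos P in auto)
  define a b where "a = s\<^sup>2 - y1 * y2" "b = s\<^sup>2 - x1 * x2"
  note ab = this
  have dx: "(x1 - x2) * (P1 * P2) = c * (y1 - y2) * a"
  proof -
    have "(x1 - x2) * (P1 * P2) = (x1 - t) * P1 * P2 - (x2 - t) * P2 * P1"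
      by (simp add: algebra_simps)
    also have "\<dots> = c * (y1 * P2 - y2 * P1)"
      unfolding eqs by (simp add: algebra_simps)
    also have "y1 * P2 - y2 * P1 = (y1 - y2) * a"
      by (simp add: defs ab algebra_simps)
    finally show ?thesis by simp
  qed
  have dy: "(y1 - y2) * (Q1 * Q2) = d * (x1 - x2) * b"
  proof -
    have "(y1 - y2) * (Q1 * Q2) = (y1 - t) * Q1 * Q2 - (y2 - t) * Q2 * Q1"
      by (simp add: algebra_simps)
    also have "\<dots> = d * (x1 * Q2 - x2 * Q1)"
      unfolding eqs by (simp add: algebra_simps)
    also have "x1 * Q2 - x2 * Q1 = (x1 - x2) * b"
      by (simp add: defs ab algebra_simps)
    finally show ?thesis by simp
  qed
  have "x1 = x2"
  proof (rule ccontr)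
    assume ne: "x1 \<noteq> x2"
    define W where "W = (P1 * P2) * (Q1 * Q2)"
    have "(x1 - x2) * W = (c * (y1 - y2) * a) * (Q1 * Q2)"
      unfolding W_def dx[symmetric] by simp
    also have "\<dots> = c * a * ((y1 - y2) * (Q1 * Q2))"
      by (simp add: mult_ac)
    also have "\<dots> = (x1 - x2) * ((c * d) * (a * b))"
      unfolding dy by (simp add: mult_ac)
    finally have W: "W = (c * d) * (a * b)" using ne by simp
    have Wpos: "W > 0" using P by (simp add: W_def)
    have "P1 * P2 = a\<^sup>2 + (s * (y1 + y2))\<^sup>2" "Q1 * Q2 = b\<^sup>2 + (s * (x1 + x2))\<^sup>2"
      by (simp_all add: defs ab power2_eq_square algebra_simps)
    then have "a\<^sup>2 * b\<^sup>2 \<le> W"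
      unfolding W_def using P by (intro mult_mono) auto
    then have "(c * d)\<^sup>2 * (a\<^sup>2 * b\<^sup>2) \<le> (c * d)\<^sup>2 * W"
      by (intro mult_left_mono) auto
    then have "W * W \<le> (c * d)\<^sup>2 * W"
      by (simp add: W power2_eq_square mult_ac)
    then have "W \<le> (c * d)\<^sup>2" using Wpos by simp
    moreover have "(c * d) * (c * d) < (P1 * Q1) * (P2 * Q2)"
      by (rule mult_strict_mono[OF W1 W2]) (use P pos in auto)
    ultimately show False by (simp add: W_def power2_eq_square mult_ac)
  qed
  with dy P show ?thesis by simp
qed

lemma div_square_plus_le:
  fixes s x :: real
  assumes "s > 0"
  shows "x / (s\<^sup>2 + x * x) \<le> 1 / (2 * s)"
proof -
  have "s\<^sup>2 + x * x > 0" using assms by (simp add: add_pos_nonneg)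
  moreover have "x * (2 * s) \<le> s\<^sup>2 + x * x"
    using zero_le_power2[of "s - x"] by (simp add: power2_eq_square algebra_simps)
  ultimately show ?thesis using assms by (simp add: pos_divide_le_eq pos_le_divide_eq mult_ac)
qed

text \<open>
  Eliminating \<open>y\<close> leaves one equation for \<open>x\<close>, solved by the intermediate value theorem on
  an interval that is long enough because \<open>z / (s\<^sup>2 + z\<^sup>2)\<close> is bounded by \<open>1 / (2 s)\<close>.
\<close>

lemma coupled_eqs_exist:
  fixes c d s t :: real
  assumes pos: "c > 0" "d > 0" "t > 0" "s > 0"
  shows "\<exists>x y. x > 0 \<and> y > 0 \<and> x = t + c * (y / (s\<^sup>2 + y * y)) \<and> y = t + d * (x / (s\<^sup>2 + x * x))"
proof -
  define g where "g = (\<lambda>x. x / (s\<^sup>2 + x * x))"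
  have den: "s\<^sup>2 + x * x > 0" for x using pos by (simp add: add_pos_nonneg)
  have g0: "g x \<ge> 0" if "x \<ge> 0" for x using that den[of x] by (simp add: g_def)
  have g1: "g x \<le> 1 / (2 * s)" for x
    using div_square_plus_le[OF pos(4)] by (simp add: g_def)
  have cont: "continuous_on A g" for A
    unfolding g_def using den by (intro continuous_intros) (metis less_irrefl)
  define h where "h = (\<lambda>x. t + c * g (t + d * g x) - x)"
  have "\<exists>x\<ge>0. x \<le> t + c * (1 / (2 * s)) \<and> h x = 0"
  proof (rule IVT2')
    have "g (t + d * g (t + c * (1 / (2 * s)))) \<le> 1 / (2 * s)" by (rule g1)
    then show "h (t + c * (1 / (2 * s))) \<le> 0"
      using pos unfolding h_def by (simp add: mult_left_mono del: times_divide_eq_right)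
    have "0 \<le> c * g (t + d * g 0)"
      using pos by (intro mult_nonneg_nonneg g0 add_nonneg_nonneg) (auto intro: g0)
    then show "0 \<le> h 0" using pos by (simp add: h_def)
    show "continuous_on {0..t + c * (1 / (2 * s))} h"
      unfolding h_def by (intro continuous_intros continuous_on_compose2[OF cont] cont) auto
  qed (use pos in auto)
  then obtain x where x: "x \<ge> 0" "x = t + c * g (t + d * g x)"
    by (auto simp: h_def)
  define y where "y = t + d * g x"
  have "y > 0" using pos g0[OF x(1)] by (simp add: y_def add_pos_nonneg)
  moreover have xe: "x = t + c * g y" unfolding y_def by (rule x(2))
  moreover have "c * g y \<ge> 0" using pos g0[of y] \<open>y > 0\<close> by simp
  then have "x > 0" using xe pos by linarith
  ultimately show ?thesis using y_def unfolding g_def by blast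
qed

text \<open>
  For \<open>t = 0\<close> the equations only determine the two sides up to the scaling
  \<open>(x, y) \<mapsto> (l x, l y)\<close>, \<open>(x', y') \<mapsto> (x' / l, y' / l)\<close>: dividing them
  gives \<open>x / y = x' / y'\<close>. The normalisation of the sums removes this freedom.
\<close>

lemma limit_eqs_side_equal:
  fixes c d s x y x' y' :: real
  assumes nn: "x \<ge> 0" "y \<ge> 0" "x' \<ge> 0" "y' \<ge> 0"
    and nz: "x + y \<noteq> 0" and sum: "x + y = x' + y'"
    and x: "x = c * (y / (s\<^sup>2 + y' * y))" and y: "y = d * (x / (s\<^sup>2 + x' * x))"
    and x': "x' = c * (y' / (s\<^sup>2 + y' * y))" and y': "y' = d * (x' / (s\<^sup>2 + x' * x))"
  shows "x > 0" "y > 0" "x' = x" "y' = y"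
proof -
  have "x = 0" if "y = 0" by (subst x) (simp add: that)
  moreover have "y = 0" if "x = 0" by (subst y) (simp add: that)
  ultimately show "x > 0" "y > 0" using nn nz by linarith+
  have "x * y' = x' * y"
    by (subst x, subst x') (simp add: mult_ac)
  then have "x * (x' + y') = x' * (x + y)"
    by (simp add: algebra_simps)
  then have "x * (x + y) = x' * (x + y)"
    unfolding sum .
  then show "x' = x" using nz by simp
  then show "y' = y" using sum by simp
qed

text \<open>
  With \<open>p = x y\<close> the equations read \<open>s\<^sup>2 x = y (c - p)\<close> and
  \<open>s\<^sup>2 y = x (d - p)\<close>. Multiplying them yields the quadratic \<open>(c - p) (d - p) = s\<^sup>4\<close>, and
  positivity of both factors selects the smaller root. This root is where the square root in the
  distribution function comes from.
\<close>

lemma limit_eqs_product: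
  fixes c d s x y :: real
  assumes pos: "c > 0" "d > 0" "s > 0" "x > 0" "y > 0"
    and x: "x = c * (y / (s\<^sup>2 + y * y))" and y: "y = d * (x / (s\<^sup>2 + x * x))"
  shows "x * y = (c + d - sqrt ((c - d)\<^sup>2 + 4 * s ^ 4)) / 2"
    and "s\<^sup>2 * x = y * (c - x * y)" and "s\<^sup>2 * y = x * (d - x * y)"
proof -
  have den: "s\<^sup>2 + x * x > 0" "s\<^sup>2 + y * y > 0" using pos by (auto simp: add_pos_pos)
  show 1: "s\<^sup>2 * x = y * (c - x * y)"
  proof -
    have "x * (s\<^sup>2 + y * y) = c * y" using clear_denominator[of x 0 c y, unfolded add_0 diff_0_right, OF x den(2)] .
    then show ?thesis by (simp add: algebra_simps)
  qed
  show 2: "s\<^sup>2 * y = x * (d - x * y)"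
  proof -
    have "y * (s\<^sup>2 + x * x) = d * x" using clear_denominator[of y 0 d x, unfolded add_0 diff_0_right, OF y den(1)] .
    then show ?thesis by (simp add: algebra_simps)
  qed
  define p where "p = x * y"
  have "0 < s\<^sup>2 * x" "0 < s\<^sup>2 * y" using pos by auto
  then have cp: "c - p > 0" "d - p > 0"
    using pos unfolding 1 2 p_def by (simp_all add: zero_less_mult_iff)
  have "(s\<^sup>2 * x) * (s\<^sup>2 * y) = (x * y) * ((c - p) * (d - p))"
    unfolding 1 2 p_def by (simp add: mult_ac)
  moreover have "(s\<^sup>2 * x) * (s\<^sup>2 * y) = (x * y) * s ^ 4"
    by (simp add: power2_eq_square power4_eq_xxxx mult_ac)
  ultimately have s4: "s ^ 4 = (c - p) * (d - p)" using pos by simp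
  have "sqrt ((c - d)\<^sup>2 + 4 * s ^ 4) = (c - p) + (d - p)"
    using cp by (intro real_sqrt_unique) (auto simp: s4 power2_eq_square algebra_simps)
  then show "x * y = (c + d - sqrt ((c - d)\<^sup>2 + 4 * s ^ 4)) / 2"
    by (simp add: p_def)
qed

lemma limit_eqs_unique:
  fixes c d s x y x' y' :: real
  assumes pos: "c > 0" "d > 0" "s > 0" and xy: "x > 0" "y > 0" and xy': "x' > 0" "y' > 0"
    and x: "x = c * (y / (s\<^sup>2 + y * y))" and y: "y = d * (x / (s\<^sup>2 + x * x))"
    and x': "x' = c * (y' / (s\<^sup>2 + y' * y'))" and y': "y' = d * (x' / (s\<^sup>2 + x' * x'))"
  shows "x' = x \<and> y' = y"
proof -
  note 1 = limit_eqs_product[OF pos xy x y] and 2 = limit_eqs_product[OF pos xy' x' y']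
  have p: "x' * y' = x * y" using 1(1) 2(1) by simp
  have "s\<^sup>2 * x\<^sup>2 = (x * y) * (c - x * y)" using 1(2) by (simp add: power2_eq_square)
  moreover have "s\<^sup>2 * x'\<^sup>2 = (x * y) * (c - x * y)" using 2(2) unfolding p[symmetric] by (simp add: power2_eq_square)
  ultimately have "s\<^sup>2 * x'\<^sup>2 = s\<^sup>2 * x\<^sup>2" by simp
  then have "x' = x" using pos xy xy' by (simp add: power2_eq_iff_nonneg)
  then show ?thesis using p xy by simp
qed

text \<open>
  The condition \<open>s\<^sup>4 < c d\<close> says that the smaller root \<open>p\<close> of
  \<open>(c - p) (d - p) = s\<^sup>4\<close> is positive; \<open>x\<close> and \<open>y\<close> are then recovered from
  \<open>s\<^sup>2 x = y (c - p)\<close> and \<open>x y = p\<close>.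
\<close>

lemma limit_eqs_exist:
  fixes c d s :: real
  assumes pos: "c > 0" "d > 0" "s > 0" and small: "s ^ 4 < c * d"
  shows "\<exists>x y. x > 0 \<and> y > 0 \<and> x = c * (y / (s\<^sup>2 + y * y)) \<and> y = d * (x / (s\<^sup>2 + x * x))"
proof -
  define D where "D = sqrt ((c - d)\<^sup>2 + 4 * s ^ 4)"
  have D2: "D\<^sup>2 = (c - d)\<^sup>2 + 4 * s ^ 4" by (simp add: D_def)
  have "\<bar>c - d\<bar> < D"
    unfolding D_def using pos by (intro real_less_rsqrt) auto
  moreover have "D < c + d"
    unfolding D_def using pos small by (intro real_less_lsqrt) (auto simp: power2_eq_square algebra_simps)
  moreover define p where "p = (c + d - D) / 2"
  ultimately have p: "p > 0" "c - p > 0" "d - p > 0" by (auto simp: field_simps)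
  have s4: "(c - p) * (d - p) = s ^ 4"
    using D2 by (simp add: p_def power2_eq_square field_simps)
  define x where "x = sqrt p * sqrt (c - p) / s"
  define y where "y = sqrt p * sqrt (d - p) / s"
  have xy0: "x > 0" "y > 0" using p pos by (auto simp: x_def y_def)
  have s2: "sqrt (c - p) * sqrt (d - p) = s\<^sup>2"
    unfolding real_sqrt_mult[symmetric] s4 by (rule real_sqrt_unique) (auto simp: power4_eq_xxxx power2_eq_square)
  have "x * y = (sqrt p * sqrt p) * (sqrt (c - p) * sqrt (d - p)) / (s * s)"
    by (simp add: x_def y_def)
  then have xy: "x * y = p" unfolding s2 using p pos by (simp add: power2_eq_square)
  have "x * s\<^sup>2 = sqrt p * sqrt (c - p) * (sqrt (c - p) * sqrt (d - p)) / s"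
    unfolding s2 by (simp add: x_def)
  also have "\<dots> = (sqrt (c - p) * sqrt (c - p)) * y" by (simp add: y_def)
  also have "\<dots> = (c - x * y) * y" using p by (simp add: xy)
  finally have 1: "x * (s\<^sup>2 + y * y) = c * y" by (simp add: algebra_simps)
  have "y * s\<^sup>2 = sqrt p * sqrt (d - p) * (sqrt (c - p) * sqrt (d - p)) / s"
    unfolding s2 by (simp add: y_def)
  also have "\<dots> = (sqrt (d - p) * sqrt (d - p)) * x" by (simp add: x_def)
  also have "\<dots> = (d - x * y) * x" using p by (simp add: xy)
  finally have 2: "y * (s\<^sup>2 + x * x) = d * x" by (simp add: algebra_simps)
  have den: "s\<^sup>2 + x * x \<noteq> 0" "s\<^sup>2 + y * y \<noteq> 0" using pos xy0 by (auto simp: add_pos_pos less_imp_neq[THEN not_sym])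
  show ?thesis
    using xy0 den 1 2 by (intro exI[of _ x] exI[of _ y]) (simp add: nonzero_eq_divide_eq)
qed

section \<open>Collapse to scalar equations\<close>

text \<open>
  Collapse of the \<open>2 n\<close> equations to four scalar ones. The new unknowns \<open>x, y, x', y'\<close> are the
  values of \<open>V q + t\<close> and \<open>V q' + t\<close> on the two parts rather than those of \<open>q\<close> and \<open>q'\<close>.
  The parameter \<open>t\<close> is arbitrary so that the case \<open>t = 0\<close> covers the master equations.
\<close>

lemma blockvec_of_fixed_point:
  fixes q q' :: "real Matrix.vec"
  assumes k: "k \<ge> 2" and m: "m \<ge> 1"
    and q: "q \<in> carrier_vec (k * m)" "q' \<in> carrier_vec (k * m)"
    and eq: "\<And>i. i < k * m \<Longrightarrow>
        q $ i = ((V_ex k m *\<^sub>v q) $ i + t) / (s\<^sup>2 + ((V_ex k m *\<^sub>v q') $ i + t) * ((V_ex k m *\<^sub>v q) $ i + t))"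
    and eq': "\<And>i. i < k * m \<Longrightarrow>
        q' $ i = ((V_ex k m *\<^sub>v q') $ i + t) / (s\<^sup>2 + ((V_ex k m *\<^sub>v q') $ i + t) * ((V_ex k m *\<^sub>v q) $ i + t))"
  obtains x y x' y' where
    "q = blockvec k m (x / (s\<^sup>2 + x' * x)) (y / (s\<^sup>2 + y' * y))"
    "q' = blockvec k m (x' / (s\<^sup>2 + x' * x)) (y' / (s\<^sup>2 + y' * y))"
    "x = t + (1 - 1 / real k) * (y / (s\<^sup>2 + y' * y))" "y = t + 1 / real k * (x / (s\<^sup>2 + x' * x))"
    "x' = t + (1 - 1 / real k) * (y' / (s\<^sup>2 + y' * y))" "y' = t + 1 / real k * (x' / (s\<^sup>2 + x' * x))"
proof -
  have k1: "k \<ge> 1" using k by simp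
  obtain a b where ab: "V_ex k m *\<^sub>v q = blockvec k m a b"
    using V_ex_mult_vec[OF k1 m q(1)] by auto
  obtain a' b' where ab': "V_ex k m *\<^sub>v q' = blockvec k m a' b'"
    using V_ex_mult_vec[OF k1 m q(2)] by auto
  define x y x' y' where "x = a + t" "y = b + t" "x' = a' + t" "y' = b' + t"
  note defs = this
  have qb: "q = blockvec k m (x / (s\<^sup>2 + x' * x)) (y / (s\<^sup>2 + y' * y))"
  proof (rule eq_vecI)
    fix i assume "i < dim_vec (blockvec k m (x / (s\<^sup>2 + x' * x)) (y / (s\<^sup>2 + y' * y)))"
    then have i: "i < k * m" by simp
    show "q $ i = blockvec k m (x / (s\<^sup>2 + x' * x)) (y / (s\<^sup>2 + y' * y)) $ i"
      unfolding eq[OF i] ab ab' index_blockvec[OF i] by (simp add: defs)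
  qed (use q in simp)
  have qb': "q' = blockvec k m (x' / (s\<^sup>2 + x' * x)) (y' / (s\<^sup>2 + y' * y))"
  proof (rule eq_vecI)
    fix i assume "i < dim_vec (blockvec k m (x' / (s\<^sup>2 + x' * x)) (y' / (s\<^sup>2 + y' * y)))"
    then have i: "i < k * m" by simp
    show "q' $ i = blockvec k m (x' / (s\<^sup>2 + x' * x)) (y' / (s\<^sup>2 + y' * y)) $ i"
      unfolding eq'[OF i] ab ab' index_blockvec[OF i] by (simp add: defs)
  qed (use q in simp)
  have "blockvec k m a b = blockvec k m ((1 - 1 / real k) * (y / (s\<^sup>2 + y' * y))) (1 / real k * (x / (s\<^sup>2 + x' * x)))"
    unfolding ab[symmetric] by (subst qb) (rule V_ex_mult_blockvec[OF k1 m])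
  then have 1: "a = (1 - 1 / real k) * (y / (s\<^sup>2 + y' * y))" "b = 1 / real k * (x / (s\<^sup>2 + x' * x))"
    unfolding blockvec_eq_iff[OF k m] by auto
  have "blockvec k m a' b' = blockvec k m ((1 - 1 / real k) * (y' / (s\<^sup>2 + y' * y))) (1 / real k * (x' / (s\<^sup>2 + x' * x)))"
    unfolding ab'[symmetric] by (subst qb') (rule V_ex_mult_blockvec[OF k1 m])
  then have 2: "a' = (1 - 1 / real k) * (y' / (s\<^sup>2 + y' * y))" "b' = 1 / real k * (x' / (s\<^sup>2 + x' * x))"
    unfolding blockvec_eq_iff[OF k m] by auto
  have "x = t + (1 - 1 / real k) * (y / (s\<^sup>2 + y' * y))"
    unfolding 1(1)[symmetric] unfolding defs by simp
  moreover have "y = t + 1 / real k * (x / (s\<^sup>2 + x' * x))"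
    unfolding 1(2)[symmetric] unfolding defs by simp
  moreover have "x' = t + (1 - 1 / real k) * (y' / (s\<^sup>2 + y' * y))"
    unfolding 2(1)[symmetric] unfolding defs by simp
  moreover have "y' = t + 1 / real k * (x' / (s\<^sup>2 + x' * x))"
    unfolding 2(2)[symmetric] unfolding defs by simp
  ultimately show ?thesis
    by (rule that[OF qb qb'])
qed

text \<open>
  The converse of the collapse, on the diagonal \<open>x' = x\<close>, \<open>y' = y\<close> where all solutions lie.
\<close>

lemma V_ex_mult_blockvec_solution:
  fixes x y s t :: real
  assumes k: "k \<ge> 2" and m: "m \<ge> 1"
    and x: "x = t + (1 - 1 / real k) * (y / (s\<^sup>2 + y * y))" and y: "y = t + 1 / real k * (x / (s\<^sup>2 + x * x))"
  shows "V_ex k m *\<^sub>v blockvec k m (x / (s\<^sup>2 + x * x)) (y / (s\<^sup>2 + y * y)) = blockvec k m (x - t) (y - t)"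
proof -
  have "(1 - 1 / real k) * (y / (s\<^sup>2 + y * y)) = x - t" "1 / real k * (x / (s\<^sup>2 + x * x)) = y - t"
    using x y by linarith+
  then show ?thesis
    using k m by (simp only: V_ex_mult_blockvec)
qed

section \<open>The regularised equations and admissibility\<close>

text \<open>
  Existence and uniqueness together evaluate the definite description, and show that both sides of
  the solution coincide.
\<close>

lemma reg_sol_V_ex:
  assumes k: "k \<ge> 2" and m: "m \<ge> 1" and s: "s > 0" and t: "t > 0"
  obtains x y where "x > 0" "y > 0"
    "reg_sol (V_ex k m) s t =
      (blockvec k m (x / (s\<^sup>2 + x * x)) (y / (s\<^sup>2 + y * y)), blockvec k m (x / (s\<^sup>2 + x * x)) (y / (s\<^sup>2 + y * y)))"
proof -
  define c d where "c = 1 - 1 / real k" "d = 1 / real k"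
  have cd: "c > 0" "d > 0" using k by (auto simp: c_d_def)
  obtain x y where xy: "x > 0" "y > 0" and
    x: "x = t + c * (y / (s\<^sup>2 + y * y))" and y: "y = t + d * (x / (s\<^sup>2 + x * x))"
    using coupled_eqs_exist[OF cd t s] by blast
  define r where "r = blockvec k m (x / (s\<^sup>2 + x * x)) (y / (s\<^sup>2 + y * y))"
  have den: "s\<^sup>2 + z * z > 0" for z using s by (simp add: add_pos_nonneg)
  have Vr: "V_ex k m *\<^sub>v r = blockvec k m (x - t) (y - t)"
    unfolding r_def by (rule V_ex_mult_blockvec_solution[OF k m x[unfolded c_d_def] y[unfolded c_d_def]])
  have sol: "reg_master_eqs (V_ex k m) s t (r, r)"
    unfolding reg_master_eqs_def prod.case transpose_V_ex[OF m] Vr dim_V_ex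
    using xy den by (auto simp: r_def)
  have "p = (r, r)" if p: "reg_master_eqs (V_ex k m) s t p" for p
  proof -
    obtain q q' where pq: "p = (q, q')" by (cases p)
    note eqs = p[unfolded pq reg_master_eqs_def prod.case transpose_V_ex[OF m] dim_V_ex]
    note q_carrier = eqs[THEN conjunct1] eqs[THEN conjunct2, THEN conjunct1]
    note eq_at = eqs[THEN conjunct2, THEN conjunct2, rule_format]
    obtain u v u' v' where
      q: "q = blockvec k m (u / (s\<^sup>2 + u' * u)) (v / (s\<^sup>2 + v' * v))"
      and q': "q' = blockvec k m (u' / (s\<^sup>2 + u' * u)) (v' / (s\<^sup>2 + v' * v))"
      and u: "u = t + c * (v / (s\<^sup>2 + v' * v))" and v: "v = t + d * (u / (s\<^sup>2 + u' * u))"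
      and u': "u' = t + c * (v' / (s\<^sup>2 + v' * v))" and v': "v' = t + d * (u' / (s\<^sup>2 + u' * u))"
      unfolding c_d_def by (rule blockvec_of_fixed_point[OF k m q_carrier
          eq_at[THEN conjunct2, THEN conjunct2, THEN conjunct1] eq_at[THEN conjunct2, THEN conjunct2, THEN conjunct2]])
    \<comment> \<open>the indices \<open>0\<close> and \<open>m\<close> are representatives of the two parts\<close>
    have "2 * m \<le> k * m" using k by (intro mult_right_mono) auto
    with k m have ix: "0 < k * m" "m < k * m" by linarith+
    have "q $ 0 > 0" "q' $ 0 > 0" "q $ m > 0" "q' $ m > 0"
      using eq_at[OF ix(1)] eq_at[OF ix(2)] by blast+
    then have "u / (s\<^sup>2 + u' * u) > 0" "u' / (s\<^sup>2 + u' * u) > 0" "v / (s\<^sup>2 + v' * v) > 0" "v' / (s\<^sup>2 + v' * v) > 0"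
      using m unfolding q q' index_blockvec[OF ix(1)] index_blockvec[OF ix(2)] by auto
    then have "c * (v / (s\<^sup>2 + v' * v)) > 0" "d * (u / (s\<^sup>2 + u' * u)) > 0"
      "c * (v' / (s\<^sup>2 + v' * v)) > 0" "d * (u' / (s\<^sup>2 + u' * u)) > 0"
      using cd by (auto simp only: mult_pos_pos)
    with u v u' v' t have pos: "u > 0" "v > 0" "u' > 0" "v' > 0"
      by linarith+
    have same: "u' = u" "v' = v"
      using coupled_eqs_unique_side[OF cd t pos(2,1,4,3) s u v u' v'] by blast+
    have "u = x" "v = y"
      using coupled_eqs_unique[OF cd t pos(1,2) xy s u[unfolded same] v[unfolded same] x y] by blast+
    then show ?thesis
      unfolding pq q q' r_def same by simp
  qed
  with sol have "reg_sol (V_ex k m) s t = (r, r)"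
    unfolding reg_sol_def by (rule the_equality)
  then show ?thesis using that xy by (simp add: r_def)
qed

text \<open>
  Both sides of the regularised solution agree, so each entry has the form
  \<open>z / (s\<^sup>2 + z\<^sup>2)\<close>, bounded by \<open>1 / (2 s)\<close> uniformly in \<open>t\<close> and \<open>m\<close>.
\<close>

lemma assumption_A2_A_ex:
  assumes k: "k \<ge> 2"
  shows "assumption_A2 (A_ex k ` {1..})"
  unfolding assumption_A2_def
proof (intro allI impI)
  fix s :: real assume s: "s > 0"
  show "\<exists>C>0. \<forall>A\<in>A_ex k ` {1..}. \<forall>t\<in>{0<..1}.
        (\<Sum>i<dim_row A. fst (reg_sol (variance_profile A) s t) $ i) / real (dim_row A) \<le> C"
  proof (intro exI[of _ "1 / (2 * s)"] conjI ballI)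
    fix A t assume "A \<in> A_ex k ` {1..}" and t: "t \<in> {0<..1::real}"
    then obtain m where m: "m \<ge> 1" and A: "A = A_ex k m" by auto
    have dim: "dim_row A = k * m" by (simp add: A A_ex_def)
    have n: "real (k * m) > 0" using k m by simp
    have "t > 0" using t by simp
    then obtain x y where "x > 0" "y > 0" and xy: "reg_sol (V_ex k m) s t =
      (blockvec k m (x / (s\<^sup>2 + x * x)) (y / (s\<^sup>2 + y * y)), blockvec k m (x / (s\<^sup>2 + x * x)) (y / (s\<^sup>2 + y * y)))"
      by (rule reg_sol_V_ex[OF k m s])
    have "(\<Sum>i<k * m. fst (reg_sol (V_ex k m) s t) $ i) \<le> (\<Sum>i<k * m. 1 / (2 * s))"
      unfolding xy using div_square_plus_le[OF s, of x] div_square_plus_le[OF s, of y]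
      by (intro sum_mono) simp
    then have "(\<Sum>i<k * m. fst (reg_sol (V_ex k m) s t) $ i) \<le> 1 / (2 * s) * real (k * m)"
      by simp
    then show "(\<Sum>i<dim_row A. fst (reg_sol (variance_profile A) s t) $ i) / real (dim_row A) \<le> 1 / (2 * s)"
      unfolding dim using n by (simp only: pos_divide_le_eq V_ex_def A)
  qed (use s in simp)
qed

section \<open>The master equations and the radial distribution function\<close>

lemma rho_star_eq: "k \<ge> 1 \<Longrightarrow> rho_star k = sqrt (sqrt (real k - 1) / real k)"
  using real_root_mult_exp[of 2 2 "real k - 1"] by (simp add: rho_star_def real_root_divide sqrt_def)

text \<open>
  The fourth power of the edge is the product of the two proportions, which is the threshold for
  solvability of the scalar limit equations.
\<close>

lemma rho_star_pow4:
  assumes "k \<ge> 1"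
  shows "rho_star k ^ 4 = (1 - 1 / real k) * (1 / real k)"
proof -
  have "rho_star k ^ 4 = ((rho_star k)\<^sup>2)\<^sup>2" by simp
  also have "\<dots> = (sqrt (real k - 1) / real k)\<^sup>2"
    using assms unfolding rho_star_eq[OF assms] by simp
  also have "\<dots> = (1 - 1 / real k) * (1 / real k)"
    using assms by (simp add: power_divide power2_eq_square[of "real k"] field_simps)
  finally show ?thesis .
qed

lemma rho_star_nonneg: "k \<ge> 1 \<Longrightarrow> rho_star k \<ge> 0"
  by (simp add: rho_star_eq)

lemma rho_star_pos: "k \<ge> 2 \<Longrightarrow> rho_star k > 0"
  by (simp add: rho_star_eq)

lemma sqrt_rho_V_ex: "k \<ge> 2 \<Longrightarrow> m \<ge> 1 \<Longrightarrow> sqrt (rho (V_ex k m)) = rho_star k"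
  by (simp add: rho_V_ex rho_star_eq)

text \<open>
  Below the edge the nonzero solution exists and is unique, which evaluates the definite description;
  again both sides coincide.
\<close>

lemma master_sol_V_ex:
  assumes k: "k \<ge> 2" and m: "m \<ge> 1" and s: "s > 0" "s < rho_star k"
  obtains x y where "x > 0" "y > 0"
    "x = (1 - 1 / real k) * (y / (s\<^sup>2 + y * y))" "y = 1 / real k * (x / (s\<^sup>2 + x * x))"
    "master_sol (V_ex k m) s =
      (blockvec k m (x / (s\<^sup>2 + x * x)) (y / (s\<^sup>2 + y * y)), blockvec k m (x / (s\<^sup>2 + x * x)) (y / (s\<^sup>2 + y * y)))"
proof -
  define c d where "c = 1 - 1 / real k" "d = 1 / real k"
  have cd: "c > 0" "d > 0" using k by (auto simp: c_d_def)
  have k1: "k \<ge> 1" using k by simp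
  have "s ^ 4 < rho_star k ^ 4"
    using s by (intro power_strict_mono) auto
  then have "s ^ 4 < c * d" using rho_star_pow4[OF k1] by (simp add: c_d_def)
  then obtain x y where xy: "x > 0" "y > 0" and
    x: "x = c * (y / (s\<^sup>2 + y * y))" and y: "y = d * (x / (s\<^sup>2 + x * x))"
    using limit_eqs_exist[OF cd s(1)] by blast
  define r where "r = blockvec k m (x / (s\<^sup>2 + x * x)) (y / (s\<^sup>2 + y * y))"
  have den: "s\<^sup>2 + z * z > 0" for z using s by (simp add: add_pos_nonneg)
  have Vr: "V_ex k m *\<^sub>v r = blockvec k m x y"
    using V_ex_mult_blockvec_solution[OF k m, of x 0 y s, unfolded add_0 diff_0_right,
        OF x[unfolded c_d_def] y[unfolded c_d_def]]
    unfolding r_def .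
  have "r \<noteq> 0\<^sub>v (k * m)"
  proof
    assume "r = 0\<^sub>v (k * m)"
    also have "0\<^sub>v (k * m) = blockvec k m 0 (0 :: real)" by (auto simp: blockvec_def)
    finally have "x / (s\<^sup>2 + x * x) = 0"
      unfolding r_def by (simp add: blockvec_eq_iff[OF k m])
    with xy den[of x] show False by simp
  qed
  moreover have "master_eqs (V_ex k m) s (r, r)"
    unfolding master_eqs_def prod.case transpose_V_ex[OF m] Vr dim_V_ex
    using xy den by (auto simp: r_def less_imp_le)
  moreover have "p = (r, r)"
    if "master_eqs (V_ex k m) s p \<and> p \<noteq> (0\<^sub>v (k * m), 0\<^sub>v (k * m))" for p
  proof -
    obtain q q' where pq: "p = (q, q')" by (cases p)
    from that have p: "master_eqs (V_ex k m) s p" and nz: "p \<noteq> (0\<^sub>v (k * m), 0\<^sub>v (k * m))" by auto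
    note eqs = p[unfolded pq master_eqs_def prod.case transpose_V_ex[OF m] dim_V_ex]
    note q_carrier = eqs[THEN conjunct1] eqs[THEN conjunct2, THEN conjunct1]
    note q_sum = eqs[THEN conjunct2, THEN conjunct2, THEN conjunct1]
    note eq_at = eqs[THEN conjunct2, THEN conjunct2, THEN conjunct2, rule_format]
    obtain u v u' v' where
      q: "q = blockvec k m (u / (s\<^sup>2 + u' * u)) (v / (s\<^sup>2 + v' * v))"
      and q': "q' = blockvec k m (u' / (s\<^sup>2 + u' * u)) (v' / (s\<^sup>2 + v' * v))"
      and u: "u = c * (v / (s\<^sup>2 + v' * v))" and v: "v = d * (u / (s\<^sup>2 + u' * u))"
      and u': "u' = c * (v' / (s\<^sup>2 + v' * v))" and v': "v' = d * (u' / (s\<^sup>2 + u' * u))"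
      unfolding c_d_def by (rule blockvec_of_fixed_point[where t = 0, unfolded add_0_left add_0_right, OF k m q_carrier
          eq_at[THEN conjunct2, THEN conjunct2, THEN conjunct1] eq_at[THEN conjunct2, THEN conjunct2, THEN conjunct2]])
    have "2 * m \<le> k * m" using k by (intro mult_right_mono) auto
    with k m have ix: "0 < k * m" "m < k * m" by linarith+
    have "q $ 0 \<ge> 0" "q' $ 0 \<ge> 0" "q $ m \<ge> 0" "q' $ m \<ge> 0"
      using eq_at[OF ix(1)] eq_at[OF ix(2)] by blast+
    then have nonneg: "u / (s\<^sup>2 + u' * u) \<ge> 0" "u' / (s\<^sup>2 + u' * u) \<ge> 0"
      "v / (s\<^sup>2 + v' * v) \<ge> 0" "v' / (s\<^sup>2 + v' * v) \<ge> 0"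
      using m unfolding q q' index_blockvec[OF ix(1)] index_blockvec[OF ix(2)] by auto
    have uv: "u \<ge> 0" "v \<ge> 0" "u' \<ge> 0" "v' \<ge> 0"
      by (subst u v u' v', intro mult_nonneg_nonneg nonneg less_imp_le[OF cd(1)] less_imp_le[OF cd(2)])+
    have mass: "(\<Sum>i<k * m. blockvec k m a b $ i) = real k * real m * (d * a + c * b)" for a b
    proof -
      have "(\<Sum>i<k * m. blockvec k m a b $ i) = (\<Sum>i<k * m. if i < m then a else b)"
        by (intro sum.cong) auto
      also have "\<dots> = real m * a + (real k - 1) * real m * b"
        by (rule sum_block_const[OF k1])
      also have "\<dots> = real k * real m * (d * a + c * b)"
        using k by (simp add: c_d_def field_simps)
      finally show ?thesis .
    qed
    have "(\<Sum>i<k * m. q $ i) = real k * real m * (v + u)"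
      unfolding q mass by (simp only: u[symmetric] v[symmetric])
    moreover have "(\<Sum>i<k * m. q' $ i) = real k * real m * (v' + u')"
      unfolding q' mass by (simp only: u'[symmetric] v'[symmetric])
    ultimately have "real k * real m * (v + u) = real k * real m * (v' + u')"
      using q_sum by (simp only:)
    then have sum: "u + v = u' + v'" using k m by simp
    \<comment> \<open>a nonzero solution has nonzero \<open>V q\<close> or \<open>V q'\<close>, and the sums tie both together\<close>
    have "u + v \<noteq> 0"
    proof
      assume "u + v = 0"
      with sum uv have "u = 0" "v = 0" "u' = 0" "v' = 0" by linarith+
      then have "p = (blockvec k m 0 0, blockvec k m 0 0)" by (simp add: pq q q')
      also have "blockvec k m 0 (0 :: real) = 0\<^sub>v (k * m)" by (auto simp: blockvec_def)
      finally show False using nz by simp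
    qed
    note same = limit_eqs_side_equal[OF uv this sum u v u' v']
    have "u = x" "v = y"
      using limit_eqs_unique[OF cd s(1) xy same(1,2) x y u[unfolded same(3,4)] v[unfolded same(3,4)]]
      by blast+
    then show ?thesis
      unfolding pq q q' r_def same(3,4) by simp
  qed
  ultimately have "(THE p. master_eqs (V_ex k m) s p \<and> p \<noteq> (0\<^sub>v (k * m), 0\<^sub>v (k * m))) = (r, r)"
    by (intro the_equality) auto
  then have "master_sol (V_ex k m) s = (r, r)"
    using s unfolding master_sol_def sqrt_rho_V_ex[OF k m] by simp
  then show ?thesis
    unfolding r_def by (rule that[OF xy x[unfolded c_d_def] y[unfolded c_d_def]])
qed

lemma F_inf_rho_star:
  assumes "k \<ge> 1"
  shows "F_inf k (rho_star k) = 1"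
proof -
  have "(real k - 2)\<^sup>2 + 4 * (real k)\<^sup>2 * rho_star k ^ 4 = (real k)\<^sup>2"
    using assms by (simp add: rho_star_pow4 power2_eq_square field_simps)
  then show ?thesis using assms by (simp add: F_inf_def)
qed

text \<open>
  Both parts contribute \<open>n x y\<close> to the scalar product, so the value is \<open>1 - 2 x y\<close>. Since
  the two proportions add up to \<open>1\<close>, this is exactly the square root in the formula for the
  product \<open>x y\<close>.
\<close>

lemma F_pos_V_ex:
  assumes k: "k \<ge> 2" and m: "m \<ge> 1" and s: "s > 0"
  shows "F_pos (V_ex k m) s = F_inf k s"
proof (cases "s < rho_star k")
  case True
  obtain x y where xy: "x > 0" "y > 0"
    and x: "x = (1 - 1 / real k) * (y / (s\<^sup>2 + y * y))" and y: "y = 1 / real k * (x / (s\<^sup>2 + x * x))"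
    and sol: "master_sol (V_ex k m) s =
      (blockvec k m (x / (s\<^sup>2 + x * x)) (y / (s\<^sup>2 + y * y)), blockvec k m (x / (s\<^sup>2 + x * x)) (y / (s\<^sup>2 + y * y)))"
    by (rule master_sol_V_ex[OF k m s True])
  have cd: "1 - 1 / real k > 0" "1 / real k > 0" and k1: "k \<ge> 1" using k by auto
  define a b where "a = x / (s\<^sup>2 + x * x)" "b = y / (s\<^sup>2 + y * y)"
  have ab: "a = real k * y" "(real k - 1) * b = real k * x"
    using x y k unfolding a_b_def[symmetric] by (auto simp: field_simps)
  have Vr: "V_ex k m *\<^sub>v blockvec k m a b = blockvec k m x y"
    using V_ex_mult_blockvec_solution[OF k m, of x 0 y s, unfolded add_0 diff_0_right, OF x y]
    unfolding a_b_def .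
  have "scalar_prod (blockvec k m a b) (blockvec k m x y) = (\<Sum>i<k * m. if i < m then a * x else b * y)"
    by (auto simp: scalar_prod_def atLeast0LessThan intro!: sum.cong)
  also have "\<dots> = real m * (a * x) + real m * ((real k - 1) * b) * y"
    using sum_block_const[OF k1, of m "a * x" "b * y"] by (simp add: mult_ac)
  also have "\<dots> = real (k * m) * (2 * (x * y))"
    unfolding ab by (simp add: algebra_simps)
  finally have "F_pos (V_ex k m) s = 1 - 2 * (x * y)"
    using k m by (simp add: F_pos_def sol a_b_def[symmetric] Vr)
  also have "\<dots> = sqrt ((1 - 1 / real k - 1 / real k)\<^sup>2 + 4 * s ^ 4)"
  proof -
    define D where "D = sqrt ((1 - 1 / real k - 1 / real k)\<^sup>2 + 4 * s ^ 4)"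
    have "x * y = (1 - D) / 2"
      using limit_eqs_product(1)[OF cd s xy x y, folded D_def] by simp
    then have "1 - 2 * (x * y) = D" by (simp add: field_simps)
    then show ?thesis by (simp only: D_def)
  qed
  also have "(1 - 1 / real k - 1 / real k)\<^sup>2 + 4 * s ^ 4 = ((real k - 2)\<^sup>2 + 4 * (real k)\<^sup>2 * s ^ 4) / (real k)\<^sup>2"
    using k by (simp add: power2_eq_square field_simps)
  finally show ?thesis
    using True k by (simp add: F_inf_def real_sqrt_divide)
next
  case False
  have "F_pos (V_ex k m) s = 1"
    using False k m V_ex_mult_vec[of k m "0\<^sub>v (k * m)"]
    by (simp add: F_pos_def master_sol_def sqrt_rho_V_ex scalar_prod_def)
  moreover have "F_inf k (rho_star k) = 1" using k by (simp add: F_inf_rho_star)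
  ultimately show ?thesis
    using False by (cases "s = rho_star k") (auto simp: F_inf_def)
qed

lemma F_inf_0: "k \<ge> 2 \<Longrightarrow> F_inf k 0 = 1 - 2 / real k"
  by (simp add: F_inf_def rho_star_nonneg diff_divide_distrib)

lemma F_V_ex:
  assumes k: "k \<ge> 2" and m: "m \<ge> 1" and s: "s \<ge> 0"
  shows "F (V_ex k m) s = F_inf k s"
proof (cases "s = 0")
  case True
  have "((\<lambda>s. 1 / real k * sqrt ((real k - 2)\<^sup>2 + 4 * (real k)\<^sup>2 * s ^ 4)) \<longlongrightarrow>
      1 / real k * sqrt ((real k - 2)\<^sup>2 + 4 * (real k)\<^sup>2 * 0 ^ 4)) (at_right 0)"
    by (intro tendsto_intros)
  moreover have "\<forall>\<^sub>F s in at_right 0. 1 / real k * sqrt ((real k - 2)\<^sup>2 + 4 * (real k)\<^sup>2 * s ^ 4) = F_pos (V_ex k m) s"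
    using eventually_at_right_less[of 0] eventually_at_right_real[OF rho_star_pos[OF k]]
    by eventually_elim (simp add: F_pos_V_ex[OF k m] F_inf_def)
  ultimately have "(F_pos (V_ex k m) \<longlongrightarrow> F_inf k 0) (at_right 0)"
    using k by (simp add: tendsto_cong F_inf_def rho_star_nonneg)
  then have "Lim (at_right 0) (F_pos (V_ex k m)) = F_inf k 0"
    by (intro tendsto_Lim) auto
  then show ?thesis by (simp add: F_def True)
qed (use s in \<open>simp add: F_def F_pos_V_ex[OF k m]\<close>)

lemma F_inf_tendsto_left:
  assumes k: "k \<ge> 2"
  shows "(F_inf k \<longlongrightarrow> 1) (at_left (rho_star k))"
proof -
  define G where "G = (\<lambda>s. 1 / real k * sqrt ((real k - 2)\<^sup>2 + 4 * (real k)\<^sup>2 * s ^ 4))"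
  have "(G \<longlongrightarrow> G (rho_star k)) (at_left (rho_star k))"
    unfolding G_def by (intro tendsto_intros)
  moreover have "G (rho_star k) = 1"
    using F_inf_rho_star[of k] k unfolding F_inf_def G_def by simp
  moreover have "\<forall>\<^sub>F s in at_left (rho_star k). G s = F_inf k s"
    by (auto simp: eventually_at_filter F_inf_def G_def)
  ultimately show ?thesis
    using Lim_transform_eventually by fastforce
qed

section \<open>Rotation invariance of Lebesgue measure on the plane\<close>

lemma measurable_Complex [measurable]:
  assumes [measurable]: "f \<in> borel_measurable M" "g \<in> borel_measurable M"
  shows "(\<lambda>x. Complex (f x) (g x)) \<in> borel_measurable M"
  unfolding Complex_eq by measurable

lemma lborel_complex_eq_distr:
  "(lborel :: complex measure) = distr (lborel \<Otimes>\<^sub>M lborel) borel (\<lambda>(x, y). Complex x y)"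
proof (rule lborel_eqI)
  have [measurable]: "(\<lambda>(x, y). Complex x y) \<in> borel_measurable (lborel \<Otimes>\<^sub>M lborel :: (real \<times> real) measure)"
    unfolding case_prod_beta by measurable
  fix l u :: complex
  assume le: "\<And>b. b \<in> Basis \<Longrightarrow> inner l b \<le> inner u b"
  have le': "Re l \<le> Re u" "Im l \<le> Im u"
    using le[of 1] le[of \<i>] by (auto simp: Basis_complex_def inner_complex_def)
  have "(\<lambda>(x, y). Complex x y) -` box l u \<inter> space (lborel \<Otimes>\<^sub>M lborel :: (real \<times> real) measure)
      = box (Re l) (Re u) \<times> box (Im l) (Im u)"
    by (auto simp: in_box_complex_iff space_pair_measure box_real)
  then show "emeasure (distr (lborel \<Otimes>\<^sub>M lborel) borel (\<lambda>(x, y). Complex x y)) (box l u)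
      = ennreal (\<Prod>b\<in>Basis. inner (u - l) b)"
    using le' by (simp add: emeasure_distr lborel.emeasure_pair_measure_Times Basis_complex_def
       inner_complex_def ennreal_mult complex_eq_iff)
qed simp

lemma nn_integral_lborel_complex:
  fixes f :: "complex \<Rightarrow> ennreal"
  assumes [measurable]: "f \<in> borel_measurable borel"
  shows "(\<integral>\<^sup>+z. f z \<partial>lborel) = (\<integral>\<^sup>+x. \<integral>\<^sup>+y. f (Complex x y) \<partial>lborel \<partial>lborel)"
    and "(\<integral>\<^sup>+z. f z \<partial>lborel) = (\<integral>\<^sup>+y. \<integral>\<^sup>+x. f (Complex x y) \<partial>lborel \<partial>lborel)"
proof -
  have [measurable]: "(\<lambda>(x, y). Complex x y) \<in> borel_measurable (lborel \<Otimes>\<^sub>M lborel :: (real \<times> real) measure)"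
    unfolding case_prod_beta by measurable
  have *: "(\<integral>\<^sup>+z. f z \<partial>lborel) = (\<integral>\<^sup>+p. f (case p of (x, y) \<Rightarrow> Complex x y) \<partial>(lborel \<Otimes>\<^sub>M lborel))"
    by (subst lborel_complex_eq_distr) (simp add: nn_integral_distr)
  show "(\<integral>\<^sup>+z. f z \<partial>lborel) = (\<integral>\<^sup>+x. \<integral>\<^sup>+y. f (Complex x y) \<partial>lborel \<partial>lborel)"
    unfolding * by (subst lborel.nn_integral_fst[symmetric]) auto
  show "(\<integral>\<^sup>+z. f z \<partial>lborel) = (\<integral>\<^sup>+y. \<integral>\<^sup>+x. f (Complex x y) \<partial>lborel \<partial>lborel)"
    unfolding * by (subst lborel_pair.nn_integral_snd[symmetric]) auto
qed

text \<open>
  By Fubini, a shear translates each line parallel to an axis.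
\<close>

lemma nn_integral_lborel_shear:
  fixes f :: "complex \<Rightarrow> ennreal"
  assumes [measurable]: "f \<in> borel_measurable borel"
  shows "(\<integral>\<^sup>+z. f (Complex (Re z + c * Im z) (Im z)) \<partial>lborel) = (\<integral>\<^sup>+z. f z \<partial>lborel)"
    and "(\<integral>\<^sup>+z. f (Complex (Re z) (Im z + c * Re z)) \<partial>lborel) = (\<integral>\<^sup>+z. f z \<partial>lborel)"
proof -
  have tr: "(\<integral>\<^sup>+x. g (x + a) \<partial>lborel) = (\<integral>\<^sup>+x. g x \<partial>lborel)"
    if [measurable]: "g \<in> borel_measurable borel" for g :: "real \<Rightarrow> ennreal" and a
    using nn_integral_real_affine[of g 1 a] by (simp add: add.commute)
  show "(\<integral>\<^sup>+z. f (Complex (Re z + c * Im z) (Im z)) \<partial>lborel) = (\<integral>\<^sup>+z. f z \<partial>lborel)"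
    by (simp add: nn_integral_lborel_complex(2) tr[of "\<lambda>x. f (Complex x _)"])
  show "(\<integral>\<^sup>+z. f (Complex (Re z) (Im z + c * Re z)) \<partial>lborel) = (\<integral>\<^sup>+z. f z \<partial>lborel)"
    by (simp add: nn_integral_lborel_complex(1) tr[of "\<lambda>y. f (Complex _ y)"])
qed

text \<open>
  A rotation by \<open>\<phi>\<close> is a product of three shears with parameters \<open>- tan (\<phi> / 2)\<close>,
  \<open>sin \<phi>\<close>, \<open>- tan (\<phi> / 2)\<close>. This fails only for the half turn, which is the square of a
  quarter turn.
\<close>

lemma nn_integral_lborel_rotate:
  fixes f :: "complex \<Rightarrow> ennreal"
  assumes f [measurable]: "f \<in> borel_measurable borel"
  shows "(\<integral>\<^sup>+z. f (cis \<theta> * z) \<partial>lborel) = (\<integral>\<^sup>+z. f z \<partial>lborel)"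
proof -
  have small: "(\<integral>\<^sup>+z. g (cis \<phi> * z) \<partial>lborel) = (\<integral>\<^sup>+z. g z \<partial>lborel)"
    if [measurable]: "g \<in> borel_measurable borel" and ne: "cos \<phi> \<noteq> -1"
    for g :: "complex \<Rightarrow> ennreal" and \<phi>
  proof -
    \<comment> \<open>\<open>t = tan (\<phi> / 2)\<close>\<close>
    define t where "t = sin \<phi> / (1 + cos \<phi>)"
    have ne': "1 + cos \<phi> \<noteq> 0" using ne by linarith
    have sc: "(sin \<phi>)\<^sup>2 = (1 - cos \<phi>) * (1 + cos \<phi>)"
      by (simp add: sin_squared_eq power2_eq_square algebra_simps)
    have t1: "t * sin \<phi> = 1 - cos \<phi>"
      using sc ne' by (simp add: t_def power2_eq_square)
    have t2: "t * (1 + cos \<phi>) = sin \<phi>"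
      using ne' by (simp add: t_def)
    define S where "S = (\<lambda>z. Complex (Re z + (- t) * Im z) (Im z))"
    define T where "T = (\<lambda>z. Complex (Re z) (Im z + sin \<phi> * Re z))"
    have [measurable]: "S \<in> borel_measurable borel" "T \<in> borel_measurable borel"
      unfolding S_def T_def by measurable
    have rot: "cis \<phi> * z = S (T (S z))" for z
    proof -
      have im: "Im z + sin \<phi> * (Re z - t * Im z) = sin \<phi> * Re z + cos \<phi> * Im z"
        using arg_cong[OF t1, of "\<lambda>x. Im z * x"] by (simp add: algebra_simps)
      have "Re z - t * Im z - t * (sin \<phi> * Re z + cos \<phi> * Im z)
          = Re z * (1 - t * sin \<phi>) - Im z * (t * (1 + cos \<phi>))"
        by (simp add: algebra_simps)
      also have "\<dots> = cos \<phi> * Re z - sin \<phi> * Im z"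
        unfolding t1 t2 by simp
      finally show ?thesis
        by (simp add: S_def T_def complex_eq_iff im add.commute)
    qed
    have "(\<integral>\<^sup>+z. g (cis \<phi> * z) \<partial>lborel) = (\<integral>\<^sup>+z. g (S (T (S z))) \<partial>lborel)"
      by (simp add: rot)
    also have "\<dots> = (\<integral>\<^sup>+z. g (S (T z)) \<partial>lborel)"
      using nn_integral_lborel_shear(1)[of "\<lambda>z. g (S (T z))" "- t"] by (simp add: S_def)
    also have "\<dots> = (\<integral>\<^sup>+z. g (S z) \<partial>lborel)"
      using nn_integral_lborel_shear(2)[of "\<lambda>z. g (S z)" "sin \<phi>"] by (simp add: T_def)
    also have "\<dots> = (\<integral>\<^sup>+z. g z \<partial>lborel)"
      using nn_integral_lborel_shear(1)[of g "- t"] by (simp add: S_def)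
    finally show ?thesis .
  qed
  show ?thesis
  proof (cases "cos \<theta> = -1")
    case False
    then show ?thesis by (rule small[OF f])
  next
    case True
    have "cos (\<theta> / 2) \<noteq> -1"
      using True cos_double_cos[of "\<theta> / 2"] by auto
    note half = small[OF _ this]
    have double: "cis \<theta> = cis (\<theta> / 2) * cis (\<theta> / 2)"
      by (simp add: cis_mult)
    show ?thesis
      unfolding double mult.assoc
      using half[of "\<lambda>z. f (cis (\<theta> / 2) * z)"] half[of f] by simp
  qed
qed

section \<open>Radial laws and radially symmetric measures\<close>

text \<open>
  Integration in polar coordinates for radial functions: differentiate the area \<open>\<pi> r\<^sup>2\<close> of
  the disc.
\<close>

lemma distr_lborel_cmod:
  "distr lborel borel cmod = density lborel (\<lambda>r. ennreal (2 * pi * r) * indicator {0..} r)"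
proof (rule measure_eqI_generator_eq[where E = "range atMost" and \<Omega> = UNIV and A = "\<lambda>n. {..real n}"])
  show "Int_stable (range (atMost :: real \<Rightarrow> real set))"
    by (auto simp: Int_stable_def intro!: image_eqI[where x = "min _ _"])
  have ball: "emeasure (distr lborel borel cmod) {..a} = ennreal (if 0 \<le> a then pi * a\<^sup>2 else 0)" for a
  proof -
    have "cmod -` {..a} = cball 0 a" by auto
    then show ?thesis
      by (auto simp: emeasure_distr emeasure_cball unit_ball_vol_2)
  qed
  then show "emeasure (distr lborel borel cmod) {..real n} \<noteq> \<infinity>" for n
    by simp
  fix X :: "real set" assume "X \<in> range atMost"
  then obtain a where a: "X = {..a}" by auto
  show "emeasure (distr lborel borel cmod) X
     = emeasure (density lborel (\<lambda>r. ennreal (2 * pi * r) * indicator {0..} r)) X"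
  proof (cases "0 \<le> a")
    case True
    have "emeasure (density lborel (\<lambda>r. ennreal (2 * pi * r) * indicator {0..} r)) X
        = (\<integral>\<^sup>+r. ennreal (2 * pi * r) * indicator {0..a} r \<partial>lborel)"
      unfolding a by (subst emeasure_density) (auto intro!: nn_integral_cong split: split_indicator)
    also have "\<dots> = ennreal (pi * a\<^sup>2 - pi * 0\<^sup>2)"
      using True by (intro nn_integral_FTC_Icc) (auto intro!: derivative_eq_intros)
    finally show ?thesis
      unfolding a ball using True by simp
  next
    case False
    have "emeasure (density lborel (\<lambda>r. ennreal (2 * pi * r) * indicator {0..} r)) X
        = (\<integral>\<^sup>+r. ennreal (2 * pi * r) * indicator {0..} r * indicator {..a} r \<partial>lborel)"
      unfolding a by (subst emeasure_density) auto
    also have "\<dots> = (\<integral>\<^sup>+r. 0 \<partial>(lborel :: real measure))"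
      using False by (intro nn_integral_cong) (auto split: split_indicator)
    finally have "emeasure (density lborel (\<lambda>r. ennreal (2 * pi * r) * indicator {0..} r)) X = 0"
      by simp
    then show ?thesis
      unfolding a ball using False by simp
  qed
qed (auto simp: borel_eq_atMost intro: real_arch_simple)

lemma nn_integral_lborel_radial:
  fixes f :: "real \<Rightarrow> ennreal"
  assumes [measurable]: "f \<in> borel_measurable borel"
  shows "(\<integral>\<^sup>+z. f (cmod z) \<partial>lborel) = (\<integral>\<^sup>+r. ennreal (2 * pi * r) * indicator {0..} r * f r \<partial>lborel)"
proof -
  have "(\<integral>\<^sup>+z. f (cmod z) \<partial>lborel) = (\<integral>\<^sup>+r. f r \<partial>distr lborel borel cmod)"
    by (simp add: nn_integral_distr)
  then show ?thesis
    unfolding distr_lborel_cmod by (simp add: nn_integral_density)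
qed

text \<open>
  A radially symmetric probability measure is a function of its radial law. Averaging the invariance
  over a uniform angle and exchanging the integrals replaces \<open>z\<close> by \<open>|z|\<close>. The uniform
  angle is taken to be the direction \<open>sgn w\<close> of a uniform point \<open>w\<close> of the unit disc, whose
  rotation invariance is that of Lebesgue measure.
\<close>

lemma emeasure_radially_symmetric:
  assumes M: "prob_space M" and sets [measurable_cong]: "sets M = sets borel"
    and sym: "radially_symmetric M"
    and B [measurable]: "B \<in> sets borel"
  shows "emeasure M B = (\<integral>\<^sup>+r. \<integral>\<^sup>+w. indicator B (sgn w * of_real r)
           \<partial>uniform_measure lborel (cball 0 1) \<partial>distr M borel cmod)"
proof -
  define K where "K = uniform_measure (lborel :: complex measure) (cball 0 1)"
  have vol: "emeasure lborel (cball (0 :: complex) 1) = ennreal pi"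
    by (simp add: emeasure_cball unit_ball_vol_2)
  have K: "prob_space K"
    unfolding K_def by (rule prob_space_uniform_measure) (simp_all add: vol)
  have [measurable_cong]: "sets K = sets borel" by (simp add: K_def)
  interpret M: prob_space M by fact
  interpret K: prob_space K by fact
  interpret KM: pair_sigma_finite K M ..
  have [measurable]: "(sgn :: complex \<Rightarrow> complex) \<in> borel_measurable borel"
    by (simp add: sgn_div_norm[abs_def])
  have [measurable]: "cball (0 :: complex) 1 \<in> sets borel" by simp
  \<comment> \<open>multiplying the disc variable by a unit leaves its law unchanged\<close>
  have rotK: "(\<integral>\<^sup>+w. g (cis \<phi> * w) \<partial>K) = (\<integral>\<^sup>+w. g w \<partial>K)"
    if [measurable]: "g \<in> borel_measurable borel" for g :: "complex \<Rightarrow> ennreal" and \<phi>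
  proof -
    have "(\<integral>\<^sup>+w. g (cis \<phi> * w) * indicator (cball 0 1) w \<partial>lborel)
        = (\<integral>\<^sup>+w. g (cis \<phi> * w) * indicator (cball 0 1) (cis \<phi> * w) \<partial>lborel)"
      by (simp add: indicator_def norm_mult)
    also have "\<dots> = (\<integral>\<^sup>+w. g w * indicator (cball 0 1) w \<partial>lborel)"
      by (rule nn_integral_lborel_rotate[of "\<lambda>w. g w * indicator (cball 0 1) w"]) measurable
    finally show ?thesis
      by (simp add: K_def nn_integral_uniform_measure)
  qed
  have rotM: "(\<integral>\<^sup>+z. indicator B (sgn w * z) \<partial>M) = emeasure M B" if "w \<noteq> 0" for w
  proof -
    have "emeasure M B = emeasure (distr M borel (\<lambda>z. cis (Arg w) * z)) B"
      using sym by (simp add: radially_symmetric_def)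
    also have "\<dots> = (\<integral>\<^sup>+z. indicator B (cis (Arg w) * z) \<partial>M)"
      by (subst nn_integral_indicator[symmetric], simp, subst nn_integral_distr) simp_all
    finally show ?thesis using that by (simp add: cis_Arg)
  qed
  have "AE w in lborel. w \<noteq> (0 :: complex)"
    by (rule AE_lborel_singleton)
  then have "AE w in K. w \<noteq> 0"
    unfolding K_def by (auto simp: AE_uniform_measure vol elim: eventually_mono)
  then have "(\<integral>\<^sup>+w. \<integral>\<^sup>+z. indicator B (sgn w * z) \<partial>M \<partial>K) = (\<integral>\<^sup>+w. emeasure M B \<partial>K)"
    by (intro nn_integral_cong_AE) (auto simp: rotM)
  then have "emeasure M B = (\<integral>\<^sup>+w. \<integral>\<^sup>+z. indicator B (sgn w * z) \<partial>M \<partial>K)"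
    by (simp add: K.emeasure_space_1)
  also have "\<dots> = (\<integral>\<^sup>+z. \<integral>\<^sup>+w. indicator B (sgn w * z) \<partial>K \<partial>M)"
    by (rule KM.Fubini'[symmetric]) simp
  also have "\<dots> = (\<integral>\<^sup>+z. \<integral>\<^sup>+w. indicator B (sgn w * of_real (cmod z)) \<partial>K \<partial>M)"
  proof (rule nn_integral_cong)
    fix z :: complex
    have "sgn w * z = sgn (cis (Arg z) * w) * of_real (cmod z)" for w
      using rcis_cmod_Arg[of z] by (simp add: rcis_def sgn_mult mult_ac)
    then show "(\<integral>\<^sup>+w. indicator B (sgn w * z) \<partial>K) = (\<integral>\<^sup>+w. indicator B (sgn w * of_real (cmod z)) \<partial>K)"
      using rotK[of "\<lambda>w. indicator B (sgn w * of_real (cmod z))" "Arg z"] by simp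
  qed
  also have "\<dots> = (\<integral>\<^sup>+r. \<integral>\<^sup>+w. indicator B (sgn w * of_real r) \<partial>K \<partial>distr M borel cmod)"
    by (subst nn_integral_distr) simp_all
  finally show ?thesis unfolding K_def .
qed

text \<open>
  Only positive radii are needed: the mass at the origin is the limit of the masses of shrinking
  discs.
\<close>

lemma radially_symmetric_measure_eqI:
  assumes M: "prob_space M" "sets M = sets borel" "radially_symmetric M"
    and N: "prob_space N" "sets N = sets borel" "radially_symmetric N"
    and eq: "\<And>s. s > 0 \<Longrightarrow> measure M {z. cmod z \<le> s} = measure N {z. cmod z \<le> s}"
  shows "M = N"
proof -
  note [measurable_cong] = M(2) N(2)
  interpret M: prob_space M by fact
  interpret N: prob_space N by fact
  interpret M': real_distribution "distr M borel cmod"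
    by (simp add: M.real_distribution_distr)
  interpret N': real_distribution "distr N borel cmod"
    by (simp add: N.real_distribution_distr)
  have cdfM: "cdf (distr M borel cmod) x = measure M {z. cmod z \<le> x}" for x
    using sets_eq_imp_space_eq[OF M(2)]
    by (auto simp: cdf_def measure_distr intro!: arg_cong[where f = "measure M"])
  have cdfN: "cdf (distr N borel cmod) x = measure N {z. cmod z \<le> x}" for x
    using sets_eq_imp_space_eq[OF N(2)]
    by (auto simp: cdf_def measure_distr intro!: arg_cong[where f = "measure N"])
  have "cdf (distr M borel cmod) x = cdf (distr N borel cmod) x" for x
  proof -
    consider "x < 0" | "x = 0" | "x > 0" by linarith
    then show ?thesis
    proof cases
      case 1
      then have "{z. cmod z \<le> x} = {}" by (auto simp: not_le intro: less_le_trans)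
      then show ?thesis by (simp add: cdfM cdfN)
    next
      case 2
      have "(cdf (distr M borel cmod) \<longlongrightarrow> cdf (distr M borel cmod) 0) (at_right 0)"
        using M'.cdf_is_right_cont by (simp add: continuous_within)
      moreover have "(cdf (distr N borel cmod) \<longlongrightarrow> cdf (distr N borel cmod) 0) (at_right 0)"
        using N'.cdf_is_right_cont by (simp add: continuous_within)
      moreover have "\<forall>\<^sub>F s in at_right 0. cdf (distr M borel cmod) s = cdf (distr N borel cmod) s"
        using eventually_at_right_less[of 0] by eventually_elim (simp add: cdfM cdfN eq)
      ultimately have "(cdf (distr N borel cmod) \<longlongrightarrow> cdf (distr M borel cmod) 0) (at_right 0)"
        by (simp add: tendsto_cong)
      then show ?thesis
        using \<open>(cdf (distr N borel cmod) \<longlongrightarrow> cdf (distr N borel cmod) 0) (at_right 0)\<close>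
          tendsto_unique[OF trivial_limit_at_right_real] 2 by blast
    next
      case 3
      then show ?thesis by (simp add: cdfM cdfN eq)
    qed
  qed
  then have "distr M borel cmod = distr N borel cmod"
    by (intro cdf_unique M'.real_distribution_axioms N'.real_distribution_axioms) auto
  then show ?thesis
    by (intro measure_eqI) (simp_all add: M N emeasure_radially_symmetric)
qed

section \<open>The measure with atom and density\<close>

text \<open>
  For \<open>k = 2\<close> the square root is \<open>4 r\<^sup>2\<close>, so the function is differentiable at \<open>0\<close>
  although its radicand vanishes there; the quotient \<open>0 / 0 = 0\<close> is the
  correct derivative.
\<close>

lemma radial_cdf_has_derivative:
  fixes r :: real
  assumes k: "k \<ge> 2" and r: "r \<ge> 0"
  shows "((\<lambda>r. 1 / real k * sqrt ((real k - 2)\<^sup>2 + 4 * (real k)\<^sup>2 * r ^ 4)) has_real_derivative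
     8 * real k * r ^ 3 / sqrt ((real k - 2)\<^sup>2 + 4 * (real k)\<^sup>2 * r ^ 4)) (at r)"
proof (cases "k = 2")
  case True
  have sq: "sqrt (16 * r ^ 4) = 4 * r\<^sup>2" for r :: real
    by (rule real_sqrt_unique) (auto simp: power2_eq_square power4_eq_xxxx)
  have "((\<lambda>r. 2 * r\<^sup>2) has_real_derivative 4 * r) (at r)"
    by (auto intro!: derivative_eq_intros)
  then show ?thesis
    by (cases "r = 0") (simp_all add: True sq power2_eq_square power3_eq_cube)
next
  case False
  then have "(real k - 2)\<^sup>2 > 0" using k by simp
  then have pos: "(real k - 2)\<^sup>2 + 4 * (real k)\<^sup>2 * r ^ 4 > 0"
    using r by (intro add_pos_nonneg) auto
  show ?thesis
    using k pos by (auto intro!: derivative_eq_intros simp: field_simps power2_eq_square)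
qed

definition mu_inf :: "nat \<Rightarrow> complex measure" where
  "mu_inf k = measure_of UNIV (sets borel) (\<lambda>B. ennreal (1 - 2 / real k) * emeasure (return borel 0) B
            + emeasure (density lborel (\<lambda>z. ennreal (f_inf k z))) B)"

lemma sets_mu_inf [simp, measurable_cong]: "sets (mu_inf k) = sets borel"
  unfolding mu_inf_def using sets.sigma_sets_eq[of "borel :: complex measure"] by simp

lemma space_mu_inf [simp]: "space (mu_inf k) = UNIV"
  using sets_eq_imp_space_eq[OF sets_mu_inf] by simp

lemma borel_measurable_f_inf [measurable]: "f_inf k \<in> borel_measurable borel"
  unfolding f_inf_def by measurable

lemma f_inf_nonneg: "f_inf k z \<ge> 0"
  by (simp add: f_inf_def)

text \<open>
  The set function is countably additive, without which \<open>measure_of\<close> would yield the zero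
  measure.
\<close>

lemma emeasure_mu_inf:
  assumes "B \<in> sets borel"
  shows "emeasure (mu_inf k) B = ennreal (1 - 2 / real k) * emeasure (return borel 0) B
            + emeasure (density lborel (\<lambda>z. ennreal (f_inf k z))) B"
proof (rule emeasure_measure_of[OF mu_inf_def])
  show "countably_additive (sets (mu_inf k)) (\<lambda>B. ennreal (1 - 2 / real k) * emeasure (return borel 0) B
            + emeasure (density lborel (\<lambda>z. ennreal (f_inf k z))) B)"
  proof (rule countably_additiveI)
    fix A :: "nat \<Rightarrow> complex set"
    assume "range A \<subseteq> sets (mu_inf k)" and dis: "disjoint_family A"
    then have A: "range A \<subseteq> sets borel" by simp
    have "(\<Sum>i. emeasure (return borel 0) (A i)) = emeasure (return borel 0) (\<Union>i. A i)"
      using A by (intro suminf_emeasure dis) simp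
    moreover have "(\<Sum>i. emeasure (density lborel (\<lambda>z. ennreal (f_inf k z))) (A i))
        = emeasure (density lborel (\<lambda>z. ennreal (f_inf k z))) (\<Union>i. A i)"
      using A by (intro suminf_emeasure dis) simp
    ultimately show "(\<Sum>i. ennreal (1 - 2 / real k) * emeasure (return borel 0) (A i)
            + emeasure (density lborel (\<lambda>z. ennreal (f_inf k z))) (A i))
        = ennreal (1 - 2 / real k) * emeasure (return borel 0) (\<Union>i. A i)
            + emeasure (density lborel (\<lambda>z. ennreal (f_inf k z))) (\<Union>i. A i)"
      by (simp add: suminf_add[symmetric] ennreal_suminf_cmult)
  qed
qed (use assms in \<open>auto simp: positive_def\<close>)

text \<open>
  The radial density \<open>2 \<pi> r f(r)\<close> is the derivative of the distribution function up to the
  edge, and the atom supplies its value at \<open>0\<close>.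
\<close>

lemma emeasure_mu_inf_disc:
  assumes k: "k \<ge> 2" and s: "s \<ge> 0"
  shows "emeasure (mu_inf k) {z. cmod z \<le> s} = ennreal (F_inf k s)"
proof -
  define \<rho> where "\<rho> = rho_star k"
  define G where "G = (\<lambda>r. 1 / real k * sqrt ((real k - 2)\<^sup>2 + 4 * (real k)\<^sup>2 * r ^ 4))"
  define g where "g = (\<lambda>r. 8 * real k * r ^ 3 / sqrt ((real k - 2)\<^sup>2 + 4 * (real k)\<^sup>2 * r ^ 4))"
  define h where "h = (\<lambda>r. 4 * real k / pi * (r\<^sup>2 / sqrt ((real k - 2)\<^sup>2 + 4 * (real k)\<^sup>2 * r ^ 4)))"
  have [measurable]: "h \<in> borel_measurable borel" by (simp add: h_def)
  have \<rho>: "\<rho> \<ge> 0" using k by (simp add: \<rho>_def rho_star_nonneg)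
  have hg: "2 * pi * r * h r = g r" for r
    by (simp add: h_def g_def power2_eq_square power3_eq_cube)
  have h0: "h r \<ge> 0" for r by (simp add: h_def)
  have "emeasure (density lborel (\<lambda>z. ennreal (f_inf k z))) {z. cmod z \<le> s}
      = (\<integral>\<^sup>+z. ennreal (h (cmod z)) * indicator {..min s \<rho>} (cmod z) \<partial>lborel)"
    by (subst emeasure_density)
      (auto intro!: nn_integral_cong simp: f_inf_def h_def \<rho>_def split: split_indicator)
  also have "\<dots> = (\<integral>\<^sup>+r. ennreal (2 * pi * r) * indicator {0..} r * (ennreal (h r) * indicator {..min s \<rho>} r) \<partial>lborel)"
    by (rule nn_integral_lborel_radial[of "\<lambda>r. ennreal (h r) * indicator {..min s \<rho>} r"]) measurable
  also have "\<dots> = (\<integral>\<^sup>+r. ennreal (g r) * indicator {0..min s \<rho>} r \<partial>lborel)"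
    by (intro nn_integral_cong)
      (auto simp: hg[symmetric] h0 ennreal_mult' mult.assoc split: split_indicator)
  also have "\<dots> = ennreal (G (min s \<rho>) - G 0)"
  proof (rule nn_integral_FTC_Icc)
    show "(G has_real_derivative g r) (at r)" if "r \<in> {0..min s \<rho>}" for r
      using radial_cdf_has_derivative[OF k, of r] that by (simp add: G_def g_def)
    show "g \<in> borel_measurable borel" by (simp add: g_def)
  qed (use s \<rho> in \<open>auto simp: g_def\<close>)
  finally have dens: "emeasure (density lborel (\<lambda>z. ennreal (f_inf k z))) {z. cmod z \<le> s}
      = ennreal (G (min s \<rho>) - G 0)" .
  have G0: "G 0 = 1 - 2 / real k"
    using k by (simp add: G_def diff_divide_distrib)
  have G\<rho>: "G (min s \<rho>) = F_inf k s"
    using F_inf_rho_star[of k] k by (simp add: G_def F_inf_def \<rho>_def min_def split: if_splits)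
  have "G 0 \<le> G (min s \<rho>)"
    using s \<rho> by (auto simp: G_def intro!: divide_right_mono real_le_rsqrt)
  moreover have "0 \<le> G 0" using k by (simp add: G0)
  ultimately show ?thesis
    using s by (simp add: emeasure_mu_inf dens G0[symmetric] G\<rho>[symmetric] ennreal_plus[symmetric] del: ennreal_plus)
qed

lemma prob_space_mu_inf:
  assumes k: "k \<ge> 2"
  shows "prob_space (mu_inf k)"
proof
  have "emeasure (density lborel (\<lambda>z. ennreal (f_inf k z))) UNIV
      = emeasure (density lborel (\<lambda>z. ennreal (f_inf k z))) {z. cmod z \<le> rho_star k}"
    by (simp add: emeasure_density) (auto intro!: nn_integral_cong simp: f_inf_def split: split_indicator)
  then have "emeasure (mu_inf k) UNIV = emeasure (mu_inf k) {z. cmod z \<le> rho_star k}"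
    using k by (simp add: emeasure_mu_inf rho_star_nonneg)
  also have "\<dots> = 1"
    using k by (simp add: emeasure_mu_inf_disc rho_star_nonneg F_inf_rho_star)
  finally show "emeasure (mu_inf k) (space (mu_inf k)) = 1" by simp
qed

lemma radially_symmetric_mu_inf: "radially_symmetric (mu_inf k)"
  unfolding radially_symmetric_def
proof (intro allI measure_eqI)
  fix \<theta> B assume "B \<in> sets (distr (mu_inf k) borel (\<lambda>z. cis \<theta> * z))"
  then have B [measurable]: "B \<in> sets borel" by simp
  define B' where "B' = (\<lambda>z. cis \<theta> * z) -` B"
  have B' [measurable]: "B' \<in> sets borel"
  proof -
    have "(\<lambda>z. cis \<theta> * z) \<in> borel_measurable borel" by measurable
    from measurable_sets[OF this B] show ?thesis
      unfolding B'_def space_borel Int_UNIV_right .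
  qed
  have "emeasure (density lborel (\<lambda>z. ennreal (f_inf k z))) B'
      = (\<integral>\<^sup>+z. ennreal (f_inf k (cis \<theta> * z)) * indicator B (cis \<theta> * z) \<partial>lborel)"
  proof -
    have "indicator B' z = (indicator B (cis \<theta> * z) :: ennreal)" for z
      by (simp add: B'_def indicator_def)
    moreover have "f_inf k (cis \<theta> * z) = f_inf k z" for z
      by (simp add: f_inf_def norm_mult indicator_def)
    ultimately show ?thesis
      by (subst emeasure_density) simp_all
  qed
  also have "\<dots> = (\<integral>\<^sup>+z. ennreal (f_inf k z) * indicator B z \<partial>lborel)"
    by (rule nn_integral_lborel_rotate[of "\<lambda>z. ennreal (f_inf k z) * indicator B z"]) measurable
  also have "\<dots> = emeasure (density lborel (\<lambda>z. ennreal (f_inf k z))) B"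
    by (subst emeasure_density) auto
  finally have "emeasure (mu_inf k) B' = emeasure (mu_inf k) B"
    by (simp add: emeasure_mu_inf) (simp add: B'_def indicator_def)
  then show "emeasure (distr (mu_inf k) borel (\<lambda>z. cis \<theta> * z)) B = emeasure (mu_inf k) B"
    by (simp add: emeasure_distr B'_def)
qed simp

lemma mu_V_ex:
  assumes k: "k \<ge> 2" and m: "m \<ge> 1"
  shows "mu (V_ex k m) = mu_inf k"
  unfolding mu_def
proof (rule the_equality)
  have meas: "measure (mu_inf k) {z. cmod z \<le> s} = F (V_ex k m) s" if "s > 0" for s
  proof -
    have "F_inf k s \<ge> 0" by (simp add: F_inf_def)
    then show ?thesis
      using that by (simp add: measure_def emeasure_mu_inf_disc[OF k] F_V_ex[OF k m])
  qed
  then show "sets (mu_inf k) = sets borel \<and> prob_space (mu_inf k) \<and> radially_symmetric (mu_inf k) \<and>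
      (\<forall>s>0. measure (mu_inf k) {z. cmod z \<le> s} = F (V_ex k m) s)"
    by (simp add: prob_space_mu_inf[OF k] radially_symmetric_mu_inf)
  fix \<mu> :: "complex measure"
  assume "sets \<mu> = sets borel \<and> prob_space \<mu> \<and> radially_symmetric \<mu> \<and>
      (\<forall>s>0. measure \<mu> {z. cmod z \<le> s} = F (V_ex k m) s)"
  then show "\<mu> = mu_inf k"
    by (intro radially_symmetric_measure_eqI)
      (simp_all add: prob_space_mu_inf[OF k] radially_symmetric_mu_inf meas)
qed

lemma density_off_0_mu_inf: "density_off_0 (mu_inf k) (f_inf k)"
  by (auto simp: density_off_0_def f_inf_nonneg emeasure_mu_inf emeasure_density)

text \<open>
  The punctured plane determines the density almost everywhere because the origin is a null set.
\<close>

lemma density_off_0_unique: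
  assumes f: "density_off_0 \<mu> f" and g: "density_off_0 \<mu> g"
  shows "AE z in lborel. f z = g z"
proof -
  have [measurable]: "f \<in> borel_measurable borel" "g \<in> borel_measurable borel"
    using f g by (auto simp: density_off_0_def)
  have *: "emeasure (density lborel (\<lambda>z. ennreal (h z))) B = emeasure \<mu> (B - {0})"
    if h: "density_off_0 \<mu> h" and B [measurable]: "B \<in> sets borel" for h B
  proof -
    have [measurable]: "h \<in> borel_measurable borel" using h by (simp add: density_off_0_def)
    have "emeasure (density lborel (\<lambda>z. ennreal (h z))) B = (\<integral>\<^sup>+z\<in>B. ennreal (h z) \<partial>lborel)"
      by (subst emeasure_density) auto
    also have "\<dots> = (\<integral>\<^sup>+z\<in>B - {0}. ennreal (h z) \<partial>lborel)"
      using AE_lborel_singleton[of "0 :: complex"]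
      by (intro nn_integral_cong_AE) (auto elim!: eventually_mono split: split_indicator)
    also have "\<dots> = emeasure \<mu> (B - {0})"
      using h by (simp add: density_off_0_def)
    finally show ?thesis .
  qed
  have "density lborel (\<lambda>z. ennreal (f z)) = density lborel (\<lambda>z. ennreal (g z))"
    by (rule measure_eqI) (simp_all add: *[OF f] *[OF g])
  then have "AE z in lborel. ennreal (f z) = ennreal (g z)"
    by (intro sigma_finite_measure.density_unique[OF sigma_finite_lborel]) simp_all
  then show ?thesis
    using f g by (auto simp: density_off_0_def elim!: eventually_mono)
qed

text \<open>
  This excludes \<open>k = 1\<close>, where the profile vanishes.
\<close>

lemma not_irreducible_A_ex_1: "\<not> irreducible_mat (A_ex 1 1)"
proof -
  have "{(u, v). u < dim_row (A_ex 1 1) \<and> v < dim_row (A_ex 1 1) \<and> A_ex 1 1 $$ (u, v) \<noteq> 0} = {}"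
  proof -
    have "A_ex 1 1 $$ (u, v) = 0" if "u < dim_row (A_ex 1 1)" "v < dim_row (A_ex 1 1)" for u v
      using that by (simp add: A_ex_def)
    then show ?thesis by blast
  qed
  then have "\<not> (0, 0) \<in> {(u, v). u < dim_row (A_ex 1 1) \<and> v < dim_row (A_ex 1 1) \<and> A_ex 1 1 $$ (u, v) \<noteq> 0}\<^sup>+"
    by (simp only: trancl_empty empty_iff not_False_eq_True)
  moreover have "0 < dim_row (A_ex 1 1)" by (simp add: A_ex_def)
  ultimately show ?thesis unfolding irreducible_mat_def by blast
qed

theorem proposition3p2:
  fixes k :: nat
  assumes "k \<ge> 1"
    and "\<And>m. m \<ge> 1 \<Longrightarrow> irreducible_mat (A_ex k m)"
  shows
    "(\<forall>m\<ge>1. rho (V_ex k m) = sqrt (real k - 1) / real k \<and> sqrt (rho (V_ex k m)) = rho_star k) \<and>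
     (assumption_A1 (A_ex k ` {1..}) \<and> assumption_A2 (A_ex k ` {1..})) \<and>
     ((\<forall>m\<ge>1. \<forall>s\<ge>0. F (V_ex k m) s = F_inf k s) \<and>
      F_inf k 0 = 1 - 2 / real k \<and>
      (F_inf k \<longlongrightarrow> 1) (at_left (rho_star k))) \<and>
     ((\<forall>m\<ge>1.
         density_off_0 (mu (V_ex k m)) (f_inf k) \<and>
         (\<forall>f. density_off_0 (mu (V_ex k m)) f \<longrightarrow> (AE z in lborel. f z = f_inf k z)) \<and>
         sets (mu (V_ex k m)) = sets borel \<and>
         (\<forall>B\<in>sets borel. emeasure (mu (V_ex k m)) B =
            ennreal (1 - 2 / real k) * emeasure (return borel 0) B
            + emeasure (density lborel (\<lambda>z. ennreal (f_inf k z))) B)) \<and>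
      f_inf k 0 = 0)"
proof -
  have "k \<noteq> 1"
    using assms(2)[of 1] not_irreducible_A_ex_1 by auto
  with assms(1) have k: "k \<ge> 2" by simp
  have "assumption_A1 (A_ex k ` {1..})"
    unfolding assumption_A1_def by (intro exI[of _ 1]) (auto simp: A_ex_def)
  moreover have "AE z in lborel. f z = f_inf k z" if "density_off_0 (mu_inf k) f" for f
    by (rule density_off_0_unique[OF that density_off_0_mu_inf])
  moreover have "f_inf k 0 = 0"
    by (simp add: f_inf_def)
  ultimately show ?thesis
    using k assumption_A2_A_ex[OF k]
    by (auto simp: rho_V_ex rho_star_eq[symmetric] F_V_ex F_inf_0 F_inf_tendsto_left
        mu_V_ex density_off_0_mu_inf emeasure_mu_inf)
qed

end
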